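(* Consider the over-the-air consensus protocol over a time-varying graph described in the context. Suppose: (i) $\sum_{k=0}^\infty\alpha(k)=\infty$, $\sum_{k=0}^\infty\alpha^2(k)<\infty$, and $1-\alpha(k)\sum_{j\in\mathcal{V}}\bar a_{ij}(k)>0$ for all $i,k$; (ii) ($L$-connectivity) there is an integer $L>0$ such that for every $k\ge0$ the union graph $(\mathcal{V},\mathcal{E}(k)\cup\dots\cup\mathcal{E}(k+L-1))$ is connected; (iii) $\alpha(k+1)\le\alpha(k)$ for all $k\ge0$ and $\limsup_{k\to\infty}\alpha(k)/\alpha(k+1)<\infty$. Then the system achieves almost sure consensus: there exists a random variable $x^*$ with $\lim_{k\to\infty}x_i(k)=x^*$ almost surely for every $i\in\mathcal{V}$.
   Context: Agents $\mathcal{V}=\{1,\dots,N\}$ communicate over a (deterministic) time-varying undirected graph $\mathcal{G}(k)=(\mathcal{V},\mathcal{E}(k))$ without self-loops, where $(i,j)\in\mathcal{E}(k)$ iff $(j,i)\in\mathcal{E}(k)$; absence of edges models link failures, and a node that has failed at time $k$ has no edges and does not update. Let $\mathcal{N}_i(k)=\{j:(i,j)\in\mathcal{E}(k)\}$. Each agent has a deterministic initial state $x_i(0)\in[0,x_{\max}]$. Fix $\rho>0$ and $u\in\mathbb{C}$ with $|u|=1$. The following random variables are all mutually independent: for each $i,k$, $\gamma_i(k)\in\{0,1\}$ with $\mathbb{P}(\gamma_i(k)=1)=p_i\in(0,1)$; for each ordered pair $(i,j)$ and $k$, $h_{ij}(k)\sim\mathcal{CN}(0,\Lambda_{ij})$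 with $\Lambda_{ij}=\Lambda_{ji}>0$; for each $i,k$, $n_i(k)\sim\mathcal{CN}(0,\sigma_i^2)$. Let $\Gamma_{ij}(k)=\gamma_i(k)(1-\gamma_j(k))+\gamma_j(k)(1-\gamma_i(k))$. Agent $i$ receives $y_i(k)=\sum_{j\in\mathcal{N}_i(k)}\Gamma_{ij}(k)h_{ij}(k)\sqrt{\rho x_j(k)}\,u+n_i(k)$ (the model treats the states as nonnegative). Define $\bar a_{ij}(k)=\rho(p_i(1-p_j)+p_j(1-p_i))\Lambda_{ij}$ if $(i,j)\in\mathcal{E}(k)$ and $0$ otherwise. With common step sizes $\alpha(k)>0$, a non-failed agent updates $x_i(k+1)=\big(1-\alpha(k)\sum_j\bar a_{ij}(k)\big)x_i(k)+\alpha(k)(|y_i(k)|^2-\sigma_i^2)$, while an agent that has failed at time $k$ keeps $x_i(k+1)=x_i(k)$. *)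

theory Defs
  imports "HOL-Probability.Probability"
begin

text \<open>Index type for the primitive random variables of the protocol:
  Gam i k = gamma_i(k), Chan i j k = h_ij(k), Noise i k = n_i(k).
  All primitive random variables are taken complex-valued (gamma is 0/1-valued).\<close>
datatype rv_idx = Gam nat nat | Chan nat nat nat | Noise nat nat

text \<open>The index set of the random variables actually used by N agents
  (channels only for ordered pairs of distinct agents; there are no self-loops).\<close>
definition used_idx :: "nat \<Rightarrow> rv_idx set" where
  "used_idx N = {Gam i k | i k. i < N} \<union> {Chan i j k | i j k. i < N \<and> j < N \<and> i \<noteq> j}
     \<union> {Noise i k | i k. i < N}"

text \<open>Density of the circularly-symmetric complex Gaussian CN(0,v) on the complex plane
  (w.r.t. Lebesgue measure on complex = R^2).\<close>
definition cn_density :: "real \<Rightarrow> complex \<Rightarrow> ennreal" where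
  "cn_density v z = ennreal (exp (- (cmod z)\<^sup>2 / v) / (pi * v))"

definition gam :: "(rv_idx \<Rightarrow> 'a \<Rightarrow> complex) \<Rightarrow> nat \<Rightarrow> nat \<Rightarrow> 'a \<Rightarrow> real" where
  "gam X i k \<omega> = Re (X (Gam i k) \<omega>)"

definition Gamma :: "(rv_idx \<Rightarrow> 'a \<Rightarrow> complex) \<Rightarrow> nat \<Rightarrow> nat \<Rightarrow> nat \<Rightarrow> 'a \<Rightarrow> real" where
  "Gamma X i j k \<omega> = gam X i k \<omega> * (1 - gam X j k \<omega>) + gam X j k \<omega> * (1 - gam X i k \<omega>)"

text \<open>Mean weights \<open>abar_ij(k)\<close>; E k i j means (i,j) is an edge of G(k).\<close>
definition abar :: "(nat \<Rightarrow> nat \<Rightarrow> nat \<Rightarrow> bool) \<Rightarrow> real \<Rightarrow> (nat \<Rightarrow> real) \<Rightarrow>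
    (nat \<Rightarrow> nat \<Rightarrow> real) \<Rightarrow> nat \<Rightarrow> nat \<Rightarrow> nat \<Rightarrow> real" where
  "abar E \<rho> p \<Lambda> k i j =
     (if E k i j then \<rho> * (p i * (1 - p j) + p j * (1 - p i)) * \<Lambda> i j else 0)"

text \<open>Received signal y_i(k), given the current states x_j(k) (as a function of j and omega).\<close>
definition recv :: "nat \<Rightarrow> (nat \<Rightarrow> nat \<Rightarrow> nat \<Rightarrow> bool) \<Rightarrow> real \<Rightarrow> complex \<Rightarrow>
    (rv_idx \<Rightarrow> 'a \<Rightarrow> complex) \<Rightarrow> (nat \<Rightarrow> 'a \<Rightarrow> real) \<Rightarrow> nat \<Rightarrow> nat \<Rightarrow> 'a \<Rightarrow> complex" where
  "recv N E \<rho> u X x k i \<omega> =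
     (\<Sum>j\<in>{j. j < N \<and> E k i j}.
        complex_of_real (Gamma X i j k \<omega>) * X (Chan i j k) \<omega>
          * complex_of_real (sqrt (\<rho> * x j \<omega>)) * u)
     + X (Noise i k) \<omega>"

text \<open>The state trajectory x_i(k)(omega) of the over-the-air consensus protocol.
  fail k i means agent i has failed at time k.\<close>
primrec state :: "nat \<Rightarrow> (nat \<Rightarrow> nat \<Rightarrow> nat \<Rightarrow> bool) \<Rightarrow> (nat \<Rightarrow> nat \<Rightarrow> bool) \<Rightarrow>
    real \<Rightarrow> complex \<Rightarrow> (nat \<Rightarrow> real) \<Rightarrow> (nat \<Rightarrow> nat \<Rightarrow> real) \<Rightarrow> (nat \<Rightarrow> real) \<Rightarrow>
    (nat \<Rightarrow> real) \<Rightarrow> (nat \<Rightarrow> real) \<Rightarrow> (rv_idx \<Rightarrow> 'a \<Rightarrow> complex) \<Rightarrow>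
    nat \<Rightarrow> nat \<Rightarrow> 'a \<Rightarrow> real" where
  "state N E fail \<rho> u p \<Lambda> \<sigma> \<alpha> x0 X 0 = (\<lambda>i \<omega>. x0 i)"
| "state N E fail \<rho> u p \<Lambda> \<sigma> \<alpha> x0 X (Suc k) =
     (let x = state N E fail \<rho> u p \<Lambda> \<sigma> \<alpha> x0 X k in
      (\<lambda>i \<omega>. if fail k i then x i \<omega>
             else (1 - \<alpha> k * (\<Sum>j<N. abar E \<rho> p \<Lambda> k i j)) * x i \<omega>
                  + \<alpha> k * ((cmod (recv N E \<rho> u X x k i \<omega>))\<^sup>2 - (\<sigma> i)\<^sup>2)))"

text \<open>Connectivity of an undirected graph on vertices {..<N}.\<close>
definition graph_connected :: "nat \<Rightarrow> (nat \<Rightarrow> nat \<Rightarrow> bool) \<Rightarrow> bool" where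
  "graph_connected N R \<longleftrightarrow>
     (\<forall>i<N. \<forall>j<N. (i, j) \<in> {(a, b). a < N \<and> b < N \<and> R a b}\<^sup>*)"

end

theory Submission
  imports Defs
begin

text \<open>Write the update as a Laplacian averaging step plus a perturbation. The amplitude
  \<open>sqrt (\<rho> * x)\<close> of a negative state is \<open>- sqrt (\<rho> * \<bar>x\<bar>)\<close>, so the conditional mean of \<open>\<bar>y\<bar>\<^sup>2\<close> involves
  \<open>\<bar>x\<^sub>j\<bar>\<close>, and the perturbation consists of the excess \<open>\<bar>x\<^sub>j\<bar> - x\<^sub>j\<close> and of centred noise. The mean
  weights are symmetric and the step sizes square summable, which bounds the second moments of the
  states. The noise therefore is a martingale bounded in \<open>L\<^sup>2\<close> and converges, and the excess, being
  the nonnegative drift of the sum of all states, is summable. The rest is pathwise: a linear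
  averaging recursion perturbed by a convergent series contracts, over each window of \<open>L\<close> steps, the
  deviation from its limit mean by a factor \<open>1 - c * \<alpha> k\<close> up to an error \<open>o(\<alpha> k)\<close>, and the step sizes
  have a divergent sum.\<close>

subsection \<open>Perturbed averaging over jointly connected graphs\<close>

text \<open>The noise is multiplicative: the fluctuation of the received power grows with the
  states, so its variance cannot be bounded before the states are. The argument closes because
  amplitudes are square roots of states: the variance at time k is at most affine in the total
  second moment \<open>energy k\<close> and enters multiplied by
  \<open>(\<alpha> k)\<^sup>2\<close>. The Euclidean norm is the right scale, because
  \<open>\<bar>x\<bar>\<^sup>2 = x\<^sup>2\<close> makes the drift nonexpansive in it in spite of
  the absolute values. The noise series is known to converge only as a series, not absolutely, so
  bounding its terms one by one would not do; its tails are moved into the state instead. No single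
  graph need be connected, so the contraction has to be read off from a window of L steps. An edge
  may be active only at the end of the window, weighted by a later step size; the ratio condition
  keeps that step size comparable to \<open>\<alpha> k\<close>. Monotonicity bounds all later step
  sizes in the window by the first and lets every L-th step represent its whole block.\<close>

lemma perturbed_contraction_tendsto_0:
  fixes u a :: "nat \<Rightarrow> real"
  assumes nonneg: "\<And>m. 0 \<le> u m"
    and diverges: "filterlim (\<lambda>n. \<Sum>m<n. a m) at_top sequentially"
    and step: "\<And>e. e > 0 \<Longrightarrow>
      \<forall>\<^sub>F m in sequentially. a m \<le> 1 \<and> u (Suc m) \<le> (1 - a m) * u m + a m * e"
  shows "u \<longlonglongrightarrow> 0"
proof (rule LIMSEQ_I)
  fix r :: real assume r: "0 < r"
  define e where "e = r / 2"
  have e: "e > 0" using r by (simp add: e_def)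
  obtain K where K: "\<And>m. m \<ge> K \<Longrightarrow> a m \<le> 1 \<and> u (Suc m) \<le> (1 - a m) * u m + a m * e"
    using step[OF e] unfolding eventually_sequentially by blast
  \<comment> \<open>Subtracting e makes the recursion homogeneous, and
    \<open>1 - a \<le> exp (- a)\<close> turns the product of the factors into the exponential of a
    partial sum. The absolute value on the right saves a case distinction on the sign of
    \<open>u K - e\<close>.\<close>
  have bound: "u (K + n) - e \<le> exp (- (\<Sum>m<n. a (K + m))) * \<bar>u K - e\<bar>" for n
  proof (induction n)
    case (Suc n)
    have a1: "a (K + n) \<le> 1" and u1: "u (Suc (K + n)) \<le> (1 - a (K + n)) * u (K + n) + a (K + n) * e"
      using K[of "K + n"] by auto
    have "u (K + Suc n) - e \<le> (1 - a (K + n)) * (u (K + n) - e)"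
      using u1 by (simp add: algebra_simps)
    also have "\<dots> \<le> (1 - a (K + n)) * (exp (- (\<Sum>m<n. a (K + m))) * \<bar>u K - e\<bar>)"
      using a1 Suc.IH by (intro mult_left_mono) auto
    also have "\<dots> \<le> exp (- a (K + n)) * (exp (- (\<Sum>m<n. a (K + m))) * \<bar>u K - e\<bar>)"
      using exp_ge_add_one_self[of "- a (K + n)"] by (intro mult_right_mono) auto
    also have "\<dots> = exp (- (\<Sum>m<Suc n. a (K + m))) * \<bar>u K - e\<bar>"
      by (simp add: exp_add[symmetric] mult.assoc[symmetric] flip: exp_add)
    finally show ?case .
  qed simp
  have shift: "(\<Sum>m<n. a (K + m)) = (\<Sum>m<n + K. a m) - (\<Sum>m<K. a m)" for n
    by (induction n) (simp_all add: add.commute)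
  have "filterlim (\<lambda>n. (\<Sum>m<n + K. a m) - (\<Sum>m<K. a m)) at_top sequentially"
    using filterlim_tendsto_add_at_top[OF tendsto_const[of "- (\<Sum>m<K. a m)"]
        filterlim_compose[OF diverges filterlim_add_const_nat_at_top[of K]]]
    by simp
  then have "filterlim (\<lambda>n. \<Sum>m<n. a (K + m)) at_top sequentially"
    by (simp only: shift)
  then have "filterlim (\<lambda>n. - (\<Sum>m<n. a (K + m))) at_bot sequentially"
    by (simp add: filterlim_uminus_at_bot)
  then have "(\<lambda>n. exp (- (\<Sum>m<n. a (K + m)))) \<longlonglongrightarrow> 0"
    by (rule filterlim_compose[OF exp_at_bot])
  then have "(\<lambda>n. exp (- (\<Sum>m<n. a (K + m))) * \<bar>u K - e\<bar>) \<longlonglongrightarrow> 0"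
    by (rule tendsto_mult_left_zero)
  then have "\<forall>\<^sub>F n in sequentially. exp (- (\<Sum>m<n. a (K + m))) * \<bar>u K - e\<bar> < e"
    using e by (rule order_tendstoD)
  then obtain n0 where n0: "\<And>n. n \<ge> n0 \<Longrightarrow> exp (- (\<Sum>m<n. a (K + m))) * \<bar>u K - e\<bar> < e"
    unfolding eventually_sequentially by blast
  have "norm (u m - 0) < r" if m: "m \<ge> K + n0" for m
  proof -
    have "n0 \<le> m - K" "K + (m - K) = m" using m by auto
    then have "u m - e < e" using bound[of "m - K"] n0[of "m - K"] by simp
    then show ?thesis using nonneg[of m] by (simp add: e_def)
  qed
  then show "\<exists>no. \<forall>m\<ge>no. norm (u m - 0) < r" by blast
qed

text \<open>The window estimate relates time k to time \<open>k + L\<close> and thus controls each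
  residue class modulo L separately; this lemma reassembles the classes.\<close>

lemma tendsto_0_of_residues:
  fixes u :: "nat \<Rightarrow> real"
  assumes "L > 0" and "\<And>r. r < L \<Longrightarrow> (\<lambda>m. u (m * L + r)) \<longlonglongrightarrow> 0"
  shows "u \<longlonglongrightarrow> 0"
proof (rule LIMSEQ_I)
  fix e :: real assume e: "0 < e"
  have "\<forall>r<L. \<exists>m0. \<forall>m\<ge>m0. norm (u (m * L + r)) < e"
    using LIMSEQ_D[OF assms(2) e] by auto
  then obtain m0 where m0: "\<And>r m. r < L \<Longrightarrow> m \<ge> m0 r \<Longrightarrow> norm (u (m * L + r)) < e"
    by metis
  \<comment> \<open>The sum of the finitely many thresholds dominates each of them, and
    \<open>k \<ge> K\<close> makes \<open>k div L\<close> exceed the sum.\<close>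
  define K where "K = L * (\<Sum>r<L. m0 r)"
  have "norm (u k - 0) < e" if "k \<ge> K" for k
  proof -
    have r: "k mod L < L" using assms(1) by simp
    have "m0 (k mod L) \<le> (\<Sum>r<L. m0 r)"
      using r by (intro member_le_sum) auto
    also have "\<dots> \<le> k div L"
      using that assms(1) by (simp add: K_def less_eq_div_iff_mult_less_eq mult.commute)
    finally show ?thesis using m0[OF r, of "k div L"] by simp
  qed
  then show "\<exists>no. \<forall>k\<ge>no. norm (u k - 0) < e" by blast
qed

section \<open>Weighted graph Laplacians: Dirichlet form, spectral gap and contraction\<close>

definition laplacian :: "nat \<Rightarrow> (nat \<Rightarrow> nat \<Rightarrow> real) \<Rightarrow> (nat \<Rightarrow> real) \<Rightarrow> nat \<Rightarrow> real" where
  "laplacian N A f i = (\<Sum>j<N. A i j * (f i - f j))"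

abbreviation nrm :: "nat \<Rightarrow> (nat \<Rightarrow> real) \<Rightarrow> real" where
  "nrm N f \<equiv> L2_set f {..<N}"

lemma nrm_power2: "(nrm N f)\<^sup>2 = (\<Sum>i<N. (f i)\<^sup>2)"
  by (simp add: L2_set_def sum_nonneg)

lemma laplacian_diff: "laplacian N A (\<lambda>i. f i - g i) i = laplacian N A f i - laplacian N A g i"
  unfolding laplacian_def sum_subtractf[symmetric] by (rule sum.cong) (auto simp: algebra_simps)

text \<open>The Dirichlet form. Exchanging the names of i and j gives a second expression for the
  left side, and adding the two completes the square.\<close>

lemma sum_laplacian_mult:
  assumes "\<And>i j. i < N \<Longrightarrow> j < N \<Longrightarrow> A i j = A j i"
  shows "(\<Sum>i<N. f i * laplacian N A f i) = (\<Sum>i<N. \<Sum>j<N. A i j * (f i - f j)\<^sup>2) / 2"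
proof -
  have "(\<Sum>i<N. f i * laplacian N A f i) = (\<Sum>i<N. \<Sum>j<N. A i j * (f i * (f i - f j)))" (is "?s = _")
    unfolding laplacian_def sum_distrib_left by (simp add: algebra_simps)
  moreover have "\<dots> = (\<Sum>i<N. \<Sum>j<N. A i j * (f j * (f j - f i)))"
    by (subst sum.swap) (intro sum.cong refl, simp add: assms)
  ultimately have "2 * ?s = (\<Sum>i<N. \<Sum>j<N. A i j * (f i * (f i - f j)) + A i j * (f j * (f j - f i)))"
    by (simp add: sum.distrib)
  also have "\<dots> = (\<Sum>i<N. \<Sum>j<N. A i j * (f i - f j)\<^sup>2)"
    by (intro sum.cong refl) (simp add: power2_eq_square algebra_simps)
  finally show ?thesis by simp
qed

text \<open>The two orientations of an edge cancel. This keeps the mean of the corrected state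
  constant, and it reduces the drift of the sum of all states to the excess.\<close>

lemma sum_laplacian:
  assumes "\<And>i j. i < N \<Longrightarrow> j < N \<Longrightarrow> A i j = A j i"
  shows "(\<Sum>i<N. laplacian N A f i) = 0"
proof -
  have "(\<Sum>i<N. laplacian N A f i) = (\<Sum>i<N. \<Sum>j<N. A i j * f i) - (\<Sum>i<N. \<Sum>j<N. A i j * f j)"
    unfolding laplacian_def by (simp add: right_diff_distrib sum_subtractf)
  also have "(\<Sum>i<N. \<Sum>j<N. A i j * f j) = (\<Sum>i<N. \<Sum>j<N. A i j * f i)"
    by (subst sum.swap) (intro sum.cong refl, simp add: assms)
  finally show ?thesis by simp
qed

text \<open>Crude passage through the sum of absolute values: N rows of N terms, each at most
  \<open>2 * K * nrm N f\<close>. Only uniformity in the weights matters later.\<close>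

lemma nrm_laplacian_le:
  assumes "\<And>i j. i < N \<Longrightarrow> j < N \<Longrightarrow> \<bar>A i j\<bar> \<le> K"
  shows "nrm N (laplacian N A f) \<le> 2 * K * (real N)\<^sup>2 * nrm N f"
proof -
  have f: "\<bar>f i\<bar> \<le> nrm N f" if "i < N" for i
    using member_le_L2_set[of "{..<N}" i f] that
      member_le_L2_set[of "{..<N}" i "\<lambda>i. \<bar>f i\<bar>"] by (simp add: L2_set_def)
  have "\<bar>laplacian N A f i\<bar> \<le> (\<Sum>j<N. K * (2 * nrm N f))" if i: "i < N" for i
    unfolding laplacian_def
  proof (rule order_trans[OF sum_abs sum_mono])
    fix j assume "j \<in> {..<N}"
    then have j: "j < N" by simp
    have "\<bar>f i - f j\<bar> \<le> 2 * nrm N f" using f[OF i] f[OF j] by linarith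
    then show "\<bar>A i j * (f i - f j)\<bar> \<le> K * (2 * nrm N f)"
      unfolding abs_mult using assms[OF i j] by (intro mult_mono) auto
  qed
  then have "(\<Sum>i<N. \<bar>laplacian N A f i\<bar>) \<le> (\<Sum>i<N. \<Sum>j<N. K * (2 * nrm N f))"
    by (intro sum_mono) auto
  then show ?thesis
    using L2_set_le_sum_abs[of "laplacian N A f" "{..<N}"]
    by (simp add: power2_eq_square algebra_simps)
qed

lemma relpow_diff_le:
  fixes f :: "nat \<Rightarrow> real"
  assumes "\<And>a b. (a, b) \<in> R \<Longrightarrow> \<bar>f a - f b\<bar> \<le> d" and "(i, j) \<in> R ^^ n"
  shows "\<bar>f i - f j\<bar> \<le> real n * d"
  using assms(2)
proof (induction n arbitrary: j)
  case (Suc n)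
  then obtain l where l: "(i, l) \<in> R ^^ n" "(l, j) \<in> R" by auto
  show ?case using Suc.IH[OF l(1)] assms(1)[OF l(2)] by (simp add: algebra_simps)
qed simp

text \<open>A path has at most \<open>N\<^sup>2\<close> edges and, for a vector of mean zero, every entry is
  the average of its differences to the other entries.\<close>

lemma poincare_graph:
  fixes f :: "nat \<Rightarrow> real"
  assumes N: "N \<ge> 1"
    and conn: "graph_connected N E"
    and zero: "(\<Sum>i<N. f i) = 0"
    and W: "\<And>i j. i < N \<Longrightarrow> j < N \<Longrightarrow> 0 \<le> W i j"
    and lower: "\<And>i j. i < N \<Longrightarrow> j < N \<Longrightarrow> E i j \<Longrightarrow> b \<le> W i j"
    and b: "0 < b"
  shows "b * (nrm N f)\<^sup>2 \<le> real N ^ 5 * (\<Sum>i<N. \<Sum>j<N. W i j * (f i - f j)\<^sup>2)"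
proof -
  define R where "R = {(i, j). i < N \<and> j < N \<and> E i j}"
  define Q where "Q = (\<Sum>i<N. \<Sum>j<N. W i j * (f i - f j)\<^sup>2)"
  \<comment> \<open>One edge of weight at least b contributes at least
    \<open>b * (f i - f j)\<^sup>2\<close> to Q, so d bounds the difference across any edge.\<close>
  define d where "d = sqrt (Q / b)"
  have RN: "R \<subseteq> {..<N} \<times> {..<N}" by (auto simp: R_def)
  have finR: "finite R" by (rule finite_subset[OF RN]) simp
  have cardR: "card R \<le> N * N" using card_mono[OF _ RN] by (simp add: card_cartesian_product)
  have Q0: "0 \<le> Q" unfolding Q_def by (intro sum_nonneg mult_nonneg_nonneg) (auto simp: W)
  have edge: "\<bar>f i - f j\<bar> \<le> d" if "(i, j) \<in> R" for i j
  proof -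
    have ij: "i < N" "j < N" "E i j" using that by (auto simp: R_def)
    have "b * (f i - f j)\<^sup>2 \<le> W i j * (f i - f j)\<^sup>2"
      using lower[OF ij] by (intro mult_right_mono) auto
    also have "\<dots> \<le> (\<Sum>j<N. W i j * (f i - f j)\<^sup>2)"
      using ij W by (intro member_le_sum[where f = "\<lambda>j. W i j * (f i - f j)\<^sup>2"]) auto
    also have "\<dots> \<le> Q" unfolding Q_def
      using ij W by (intro member_le_sum[where f = "\<lambda>i. \<Sum>j<N. W i j * (f i - f j)\<^sup>2"])
        (auto intro!: sum_nonneg)
    finally have "(f i - f j)\<^sup>2 \<le> Q / b" using b by (simp add: field_simps)
    then have "sqrt ((f i - f j)\<^sup>2) \<le> d" unfolding d_def by (rule real_sqrt_le_mono)
    then show ?thesis by simp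
  qed
  have d0: "0 \<le> d" and d2: "d\<^sup>2 = Q / b" using Q0 b by (simp_all add: d_def)
  have pair: "\<bar>f i - f j\<bar> \<le> (real N)\<^sup>2 * d" if "i < N" "j < N" for i j
  proof -
    have "(i, j) \<in> R\<^sup>*" using conn that unfolding graph_connected_def R_def by auto
    \<comment> \<open>The path length is bounded by the number of pairs in R, which is where
      \<open>N\<^sup>2\<close> comes from.\<close>
    then obtain n where n: "n \<le> card R" "(i, j) \<in> R ^^ n"
      using rtrancl_finite_eq_relpow[OF finR] by auto
    have "\<bar>f i - f j\<bar> \<le> real n * d" by (rule relpow_diff_le[OF edge n(2)])
    also have "\<dots> \<le> real (N * N) * d"
      using n(1) cardR d0 by (intro mult_right_mono) (simp_all del: of_nat_mult)
    finally show ?thesis by (simp add: power2_eq_square)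
  qed
  have entry: "\<bar>f i\<bar> \<le> (real N)\<^sup>2 * d" if "i < N" for i
  proof -
    have "real N * f i = (\<Sum>j<N. f i - f j)" by (simp add: sum_subtractf zero)
    then have "real N * \<bar>f i\<bar> = \<bar>\<Sum>j<N. f i - f j\<bar>" by (metis abs_mult abs_of_nat)
    also have "\<dots> \<le> (\<Sum>j<N. \<bar>f i - f j\<bar>)" by (rule sum_abs)
    also have "\<dots> \<le> (\<Sum>j<N. (real N)\<^sup>2 * d)" using pair[OF that] by (intro sum_mono) auto
    finally show ?thesis using N by simp
  qed
  \<comment> \<open>N entries, each at most \<open>N\<^sup>2 * d\<close> in absolute value, give the
    constant \<open>N * (N\<^sup>2)\<^sup>2 = N ^ 5\<close>.\<close>
  have "(nrm N f)\<^sup>2 = (\<Sum>i<N. (f i)\<^sup>2)" by (rule nrm_power2)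
  also have "\<dots> \<le> (\<Sum>i<N. ((real N)\<^sup>2 * d)\<^sup>2)"
    using entry by (intro sum_mono) (metis abs_ge_zero lessThan_iff power2_abs power_mono)
  also have "\<dots> = real N * (((real N)\<^sup>2)\<^sup>2 * d\<^sup>2)" by (simp add: power_mult_distrib)
  also have "\<dots> = real N ^ 5 * (Q / b)" unfolding d2 by (simp add: eval_nat_numeral)
  finally show ?thesis using b by (simp add: Q_def field_simps)
qed

text \<open>In the expansion of \<open>\<bar>f - Lf\<bar>\<^sup>2\<close> the cross term gains at
  least \<open>s * b / N ^ 5\<close> by the Poincare inequality, while the square of the Laplacian
  is of order \<open>s\<^sup>2\<close>; \<open>small1\<close> lets it consume at most half of the
  gain. Passing from squares to norms halves the rest, hence the 4 in
  \<open>b / (4 * N ^ 5)\<close>. \<open>small2\<close> keeps the factor nonnegative, so that the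
  square root may be taken.\<close>

lemma laplacian_contraction:
  fixes f :: "nat \<Rightarrow> real"
  assumes N: "N \<ge> 1"
    and conn: "graph_connected N E"
    and zero: "(\<Sum>i<N. f i) = 0"
    and sym: "\<And>i j. i < N \<Longrightarrow> j < N \<Longrightarrow> W i j = W j i"
    and W: "\<And>i j. i < N \<Longrightarrow> j < N \<Longrightarrow> 0 \<le> W i j \<and> W i j \<le> s * K"
    and lower: "\<And>i j. i < N \<Longrightarrow> j < N \<Longrightarrow> E i j \<Longrightarrow> s * b \<le> W i j"
    and b: "0 < b" and s: "0 < s"
    and small1: "4 * K\<^sup>2 * real N ^ 4 * s \<le> b / (2 * real N ^ 5)"
    and small2: "b / (4 * real N ^ 5) * s \<le> 1"
  shows "nrm N (\<lambda>i. f i - laplacian N W f i) \<le> (1 - b / (4 * real N ^ 5) * s) * nrm N f"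
proof -
  let ?c = "b / (4 * real N ^ 5)"
  have Q: "s * b / real N ^ 5 * (nrm N f)\<^sup>2 \<le> 2 * (\<Sum>i<N. f i * laplacian N W f i)"
    using poincare_graph[OF N conn zero, of W "s * b"] W lower b s N
      sum_laplacian_mult[of N W f] sym
    by (simp add: field_simps)
  have "nrm N (laplacian N W f) \<le> 2 * (s * K) * (real N)\<^sup>2 * nrm N f"
    using W by (intro nrm_laplacian_le) auto
  then have "(nrm N (laplacian N W f))\<^sup>2 \<le> (2 * (s * K) * (real N)\<^sup>2 * nrm N f)\<^sup>2"
    by (intro power_mono) auto
  also have "\<dots> = s * (4 * K\<^sup>2 * real N ^ 4 * s) * (nrm N f)\<^sup>2"
    by (simp add: power_mult_distrib power2_eq_square numeral_eq_Suc)
  also have "\<dots> \<le> s * (b / (2 * real N ^ 5)) * (nrm N f)\<^sup>2"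
    using small1 s by (intro mult_right_mono mult_left_mono) auto
  finally have Lsq: "(nrm N (laplacian N W f))\<^sup>2 \<le> s * (b / (2 * real N ^ 5)) * (nrm N f)\<^sup>2" .
  have "(nrm N (\<lambda>i. f i - laplacian N W f i))\<^sup>2 =
    (nrm N f)\<^sup>2 - 2 * (\<Sum>i<N. f i * laplacian N W f i) + (nrm N (laplacian N W f))\<^sup>2"
    unfolding nrm_power2 by (simp add: power2_diff sum.distrib sum_subtractf sum_distrib_left
        algebra_simps)
  also have "\<dots> \<le> (nrm N f)\<^sup>2 - s * b / real N ^ 5 * (nrm N f)\<^sup>2
      + s * (b / (2 * real N ^ 5)) * (nrm N f)\<^sup>2"
    using Q Lsq by linarith
  also have "\<dots> = (1 - 2 * ?c * s) * (nrm N f)\<^sup>2" using N by (simp add: field_simps)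
  also have "\<dots> \<le> (1 - ?c * s)\<^sup>2 * (nrm N f)\<^sup>2"
    by (intro mult_right_mono) (simp_all add: power2_diff)
  finally have "(nrm N (\<lambda>i. f i - laplacian N W f i))\<^sup>2 \<le> ((1 - ?c * s) * nrm N f)\<^sup>2"
    by (simp add: power_mult_distrib)
  moreover have "0 \<le> (1 - ?c * s) * nrm N f"
    using small2 by (intro mult_nonneg_nonneg L2_set_nonneg) linarith
  ultimately show ?thesis by (rule power2_le_imp_le)
qed

text \<open>The pathwise setting, free of probability. The bounds b and K hold for all times: an
  edge counts in the union graph only if its weight is at least b at some time of the window, so
  connectivity comes with a quantitative weight.\<close>

locale averaging_recursion =
  fixes N L :: nat and A :: "nat \<Rightarrow> nat \<Rightarrow> nat \<Rightarrow> real" and \<alpha> :: "nat \<Rightarrow> real"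
    and K b B :: real
  assumes N1: "N \<ge> 1"
    and L0: "L > 0"
    and sym: "\<And>k i j. i < N \<Longrightarrow> j < N \<Longrightarrow> A k i j = A k j i"
    and A_bounds: "\<And>k i j. i < N \<Longrightarrow> j < N \<Longrightarrow> 0 \<le> A k i j \<and> A k i j \<le> K"
    and b0: "0 < b"
    and conn: "\<And>k. graph_connected N (\<lambda>i j. \<exists>l\<in>{k..<k + L}. b \<le> A l i j)"
    and step_pos: "\<And>k. 0 < \<alpha> k"
    and step_decreasing: "\<And>k. \<alpha> (Suc k) \<le> \<alpha> k"
    and step_diverges: "filterlim (\<lambda>n. \<Sum>k<n. \<alpha> k) at_top sequentially"
    and step_null: "\<alpha> \<longlonglongrightarrow> 0"
    and step_ratio: "\<forall>\<^sub>F k in sequentially. \<alpha> k \<le> B * \<alpha> (Suc k)"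
begin

lemma K0: "0 \<le> K"
  using A_bounds[of 0 0 0] N1 by linarith

lemma step_antimono: "k \<le> l \<Longrightarrow> \<alpha> l \<le> \<alpha> k"
  using step_decreasing by (rule lift_Suc_antimono_le)

text \<open>An edge used at the end of a window still carries a step size of at least
  \<open>\<alpha> k / max 1 B ^ L\<close>. The \<open>max 1\<close> keeps the powers nonnegative
  during the iteration and makes the final constant at least 1.\<close>

lemma step_window_le: "\<forall>\<^sub>F k in sequentially. \<alpha> k \<le> max 1 B ^ L * \<alpha> (k + L)"
proof -
  have "\<forall>\<^sub>F k in sequentially. \<alpha> k \<le> max 1 B ^ n * \<alpha> (k + n)" for n
  proof (induction n)
    case (Suc n)
    have "\<forall>\<^sub>F k in sequentially. \<alpha> (k + n) \<le> B * \<alpha> (Suc (k + n))"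
      using step_ratio unfolding eventually_sequentially by (meson trans_le_add1)
    with Suc show ?case
    proof eventually_elim
      case (elim k)
      have "\<alpha> (k + n) \<le> max 1 B * \<alpha> (k + Suc n)"
        using order_trans[OF elim(2) mult_right_mono[of B "max 1 B" "\<alpha> (Suc (k + n))"]]
          step_pos[of "Suc (k + n)"] by simp
      then have "max 1 B ^ n * \<alpha> (k + n) \<le> max 1 B ^ n * (max 1 B * \<alpha> (k + Suc n))"
        by (intro mult_left_mono) auto
      from order_trans[OF elim(1) this] show ?case by (simp add: mult_ac)
    qed
  qed simp
  then show ?thesis .
qed

text \<open>By monotonicity a block of L consecutive step sizes is at most L times one sampled step
  size, so sampling every L-th step preserves divergence.\<close>

lemma step_subsequence_diverges:
  "filterlim (\<lambda>n. \<Sum>m<n. \<alpha> (m * L + r)) at_top sequentially"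
proof -
  have le: "(\<Sum>k<n * L. \<alpha> (L + r + k)) \<le> real L * (\<Sum>m<n. \<alpha> (m * L + r))" for n
  proof -
    have "(\<Sum>k<n * L. \<alpha> (L + r + k)) = (\<Sum>m<n. \<Sum>k\<in>{m * L..<m * L + L}. \<alpha> (L + r + k))"
      by (rule sum.nat_group[symmetric])
    also have "\<dots> \<le> (\<Sum>m<n. \<Sum>k\<in>{m * L..<m * L + L}. \<alpha> (m * L + r))"
      by (intro sum_mono step_antimono) auto
    finally show ?thesis by (simp add: sum_distrib_left)
  qed
  have shift: "(\<Sum>k<n. \<alpha> (L + r + k)) = (\<Sum>k<n + (L + r). \<alpha> k) - (\<Sum>k<L + r. \<alpha> k)" for n
    by (induction n) (simp_all add: add_ac)
  have "filterlim (\<lambda>n. (\<Sum>k<n + (L + r). \<alpha> k) - (\<Sum>k<L + r. \<alpha> k)) at_top sequentially"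
    using filterlim_tendsto_add_at_top[OF tendsto_const[of "- (\<Sum>k<L + r. \<alpha> k)"]
        filterlim_compose[OF step_diverges filterlim_add_const_nat_at_top[of "L + r"]]]
    by simp
  then have "filterlim (\<lambda>n. \<Sum>k<n. \<alpha> (L + r + k)) at_top sequentially"
    by (simp only: shift)
  moreover have "filterlim (\<lambda>n. n * L) at_top sequentially"
    using L0 by (intro filterlim_subseq) (auto simp: strict_mono_def)
  ultimately have "filterlim (\<lambda>n. \<Sum>k<n * L. \<alpha> (L + r + k)) at_top sequentially"
    by (rule filterlim_compose)
  then have "filterlim (\<lambda>n. real L * (\<Sum>m<n. \<alpha> (m * L + r))) at_top sequentially"
    by (rule filterlim_at_top_mono) (simp add: le)
  then show ?thesis
    using L0 filterlim_tendsto_pos_mult_at_top[OF tendsto_const[of "1 / real L"], of "\<lambda>n. real L * (\<Sum>m<n. \<alpha> (m * L + r))"]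
    by simp
qed

lemma nrm_lap_le: "nrm N (laplacian N (A k) f) \<le> 2 * K * (real N)\<^sup>2 * nrm N f"
  using A_bounds by (intro nrm_laplacian_le) auto

lemma nrm_scale: "0 \<le> c \<Longrightarrow> nrm N (\<lambda>i. c * f i) = c * nrm N f"
  by (simp add: L2_set_right_distrib)

lemma nrm_uminus: "nrm N (\<lambda>i. - f i) = nrm N f"
  by (simp add: L2_set_def)

lemma nrm_diff_le: "nrm N (\<lambda>i. f i - g i) \<le> nrm N f + nrm N g"
  using L2_set_triangle_ineq[of f "\<lambda>i. - g i" "{..<N}"] by (simp add: nrm_uminus)

lemma nrm_add_scale_le: "0 \<le> c \<Longrightarrow> nrm N (\<lambda>i. f i + c * g i) \<le> nrm N f + c * nrm N g"
  using L2_set_triangle_ineq[of f "\<lambda>i. c * g i" "{..<N}"] by (simp add: nrm_scale)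

lemma nrm_sum_le: "nrm N (\<lambda>i. \<Sum>l<(n::nat). f l i) \<le> (\<Sum>l<n. nrm N (f l))"
proof (induction n)
  case (Suc n)
  then show ?case
    using L2_set_triangle_ineq[of "\<lambda>i. \<Sum>l<n. f l i" "f n" "{..<N}"] by simp
qed (simp add: L2_set_def)

text \<open>A predicate rather than an assumption, so that the constant in
  \<open>window_drift\<close> can be chosen before the trajectory. The perturbation carries the
  factor \<open>\<alpha> l\<close>, hence g need only tend to zero and need not be summable.\<close>

definition trajectory :: "(nat \<Rightarrow> nat \<Rightarrow> real) \<Rightarrow> (nat \<Rightarrow> nat \<Rightarrow> real) \<Rightarrow> bool" where
  "trajectory y g \<longleftrightarrow> (\<forall>l i. i < N \<longrightarrow>
     y (Suc l) i = y l i - \<alpha> l * laplacian N (A l) (y l) i + \<alpha> l * g l i)"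

text \<open>Within n steps the state moves only by an amount of order \<open>\<alpha> k\<close>.
  Replacing \<open>y (k + l)\<close> by \<open>y k\<close> inside a Laplacian term, itself of order
  \<open>\<alpha> k\<close>, then costs only a second-order error. D depends on n alone.\<close>

lemma window_drift:
  "\<exists>D\<ge>0. \<forall>y g e k.
     trajectory y g \<longrightarrow>
     (\<forall>l\<ge>k. nrm N (g l) \<le> e) \<longrightarrow>
     nrm N (\<lambda>i. y (k + n) i - y k i) \<le> D * \<alpha> k * (nrm N (y k) + e)"
proof (induction n)
  case 0
  show ?case by (rule exI[of _ 0]) (simp add: L2_set_def)
next
  case (Suc n)
  then obtain D where D: "D \<ge> 0" and IH: "\<And>y g e k.
     trajectory y g \<Longrightarrow>
     (\<forall>l\<ge>k. nrm N (g l) \<le> e) \<Longrightarrow>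
     nrm N (\<lambda>i. y (k + n) i - y k i) \<le> D * \<alpha> k * (nrm N (y k) + e)"
    by blast
  define C where "C = 2 * K * (real N)\<^sup>2"
  have C: "0 \<le> C" using K0 by (simp add: C_def)
  show ?case
  \<comment> \<open>D comes from the first n steps, \<open>C * (1 + D * \<alpha> 0)\<close> from the
    Laplacian at the last state, and 1 from the perturbation, since \<open>e \<le> ?Y\<close>. Using
    \<open>\<alpha> 0\<close> in place of \<open>\<alpha> k\<close> makes the constant independent
    of k.\<close>
  proof (intro exI[of _ "D + C * (1 + D * \<alpha> 0) + 1"] conjI allI impI)
    show "0 \<le> D + C * (1 + D * \<alpha> 0) + 1"
      using D C step_pos[of 0] by (intro add_nonneg_nonneg mult_nonneg_nonneg) auto
  next
    fix y g :: "nat \<Rightarrow> nat \<Rightarrow> real" and e k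
    assume rec: "trajectory y g"
      and g: "\<forall>l\<ge>k. nrm N (g l) \<le> e"
    have e: "0 \<le> e" using g L2_set_nonneg order_trans by blast
    let ?m = "k + n"
    let ?Y = "nrm N (y k) + e"
    have Y: "0 \<le> ?Y" using e by (simp add: L2_set_nonneg)
    have am: "\<alpha> ?m \<le> \<alpha> k" "\<alpha> k \<le> \<alpha> 0" by (auto intro: step_antimono)
    have d: "nrm N (\<lambda>i. y ?m i - y k i) \<le> D * \<alpha> k * ?Y" by (rule IH[OF rec g])
    have "nrm N (y ?m) \<le> nrm N (y k) + nrm N (\<lambda>i. y ?m i - y k i)"
      using L2_set_triangle_ineq[of "y k" "\<lambda>i. y ?m i - y k i" "{..<N}"] by simp
    also have "\<dots> \<le> ?Y + D * \<alpha> k * ?Y" using d e by simp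
    also have "\<dots> \<le> ?Y + D * \<alpha> 0 * ?Y"
      using am D Y by (intro add_left_mono mult_right_mono mult_left_mono)
    finally have ym: "nrm N (y ?m) \<le> (1 + D * \<alpha> 0) * ?Y" by (simp add: algebra_simps)
    have "nrm N (\<lambda>i. y (k + Suc n) i - y k i) =
      nrm N (\<lambda>i. (y ?m i - y k i) + \<alpha> ?m * (g ?m i - laplacian N (A ?m) (y ?m) i))"
      using rec by (intro L2_set_cong) (auto simp: trajectory_def algebra_simps)
    also have "\<dots> \<le> nrm N (\<lambda>i. y ?m i - y k i) +
        \<alpha> ?m * nrm N (\<lambda>i. g ?m i - laplacian N (A ?m) (y ?m) i)"
      using step_pos[of ?m] by (intro nrm_add_scale_le) simp
    also have "\<dots> \<le> D * \<alpha> k * ?Y + \<alpha> k * (e + C * ((1 + D * \<alpha> 0) * ?Y))"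
    proof (intro add_mono mult_mono d am)
      have "nrm N (\<lambda>i. g ?m i - laplacian N (A ?m) (y ?m) i)
          \<le> nrm N (g ?m) + nrm N (laplacian N (A ?m) (y ?m))" by (rule nrm_diff_le)
      also have "\<dots> \<le> e + C * nrm N (y ?m)"
        using g nrm_lap_le by (intro add_mono) (auto simp: C_def)
      also have "\<dots> \<le> e + C * ((1 + D * \<alpha> 0) * ?Y)"
        using ym C by (intro add_left_mono mult_left_mono)
      finally show "nrm N (\<lambda>i. g ?m i - laplacian N (A ?m) (y ?m) i) \<le> e + C * ((1 + D * \<alpha> 0) * ?Y)" .
    qed (use step_pos[of k] in \<open>auto simp: L2_set_nonneg\<close>)
    also have "\<dots> \<le> D * \<alpha> k * ?Y + \<alpha> k * (?Y + C * ((1 + D * \<alpha> 0) * ?Y))"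
      using step_pos[of k] by (intro add_left_mono mult_left_mono add_right_mono) (auto simp: L2_set_nonneg)
    finally show "nrm N (\<lambda>i. y (k + Suc n) i - y k i) \<le> (D + C * (1 + D * \<alpha> 0) + 1) * \<alpha> k * ?Y"
      by (simp add: algebra_simps)
  qed
qed

lemma disagreement_vanishes:
  assumes rec: "\<And>k i. i < N \<Longrightarrow>
      y (Suc k) i = y k i - \<alpha> k * laplacian N (A k) (y k) i + \<alpha> k * g k i"
    and zero: "\<And>k. (\<Sum>i<N. y k i) = 0"
    and g: "(\<lambda>k. nrm N (g k)) \<longlonglongrightarrow> 0"
  shows "(\<lambda>k. nrm N (y k)) \<longlonglongrightarrow> 0"
proof (rule tendsto_0_of_residues[OF L0])
  fix r assume "r < L"
  have traj: "trajectory y g" unfolding trajectory_def using rec by blast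
  have "\<forall>n. \<exists>D\<ge>0. \<forall>y g e k. trajectory y g \<longrightarrow> (\<forall>l\<ge>k. nrm N (g l) \<le> e) \<longrightarrow>
     nrm N (\<lambda>i. y (k + n) i - y k i) \<le> D * \<alpha> k * (nrm N (y k) + e)"
    using window_drift by blast
  from choice[OF this] obtain D where D': "\<forall>n. 0 \<le> D n \<and> (\<forall>y g e k. trajectory y g \<longrightarrow>
     (\<forall>l\<ge>k. nrm N (g l) \<le> e) \<longrightarrow>
     nrm N (\<lambda>i. y (k + n) i - y k i) \<le> D n * \<alpha> k * (nrm N (y k) + e))" by blast
  have D0: "D n \<ge> 0" for n using D' by blast
  have D: "nrm N (\<lambda>i. y (k + n) i - y k i) \<le> D n * \<alpha> k * (nrm N (y k) + e)"
    if "\<forall>l\<ge>k. nrm N (g l) \<le> e" for n e k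
    using D' traj that by blast
  define C where "C = 2 * K * (real N)\<^sup>2"
  have C: "0 \<le> C" using K0 by (simp add: C_def)
  define S where "S = C * (\<Sum>l<L. D l)"
  have S: "0 \<le> S" unfolding S_def using C D0 by (simp add: sum_nonneg)
  define P where "P = max 1 B ^ L"
  have P: "1 \<le> P" by (simp add: P_def)
  \<comment> \<open>The rate of \<open>laplacian_contraction\<close> with b replaced by
    \<open>b / P\<close>, the guaranteed edge weight relative to \<open>\<alpha> k\<close>.\<close>
  define c where "c = b / P / (4 * real N ^ 5)"
  have c: "0 < c" using b0 P N1 by (simp add: c_def)
  \<comment> \<open>Only \<open>c / 2\<close> of the rate c survives: the other half absorbs the
    part of the freezing error proportional to \<open>nrm N (y k)\<close>, by
    \<open>small3\<close>.\<close>
  have window: "nrm N (y (k + L)) \<le> (1 - c / 2 * \<alpha> k) * nrm N (y k) + \<alpha> k * (real L + S * \<alpha> 0) * e"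
    if g_le: "\<forall>l\<ge>k. nrm N (g l) \<le> e" and ratio: "\<alpha> k \<le> P * \<alpha> (k + L)"
      and small1: "4 * (real L * K)\<^sup>2 * real N ^ 4 * \<alpha> k \<le> b / P / (2 * real N ^ 5)"
      and small2: "c * \<alpha> k \<le> 1" and small3: "S * \<alpha> k \<le> c / 2" for k e
  proof -
    define W where "W i j = (\<Sum>l<L. \<alpha> (k + l) * A (k + l) i j)" for i j
    have e: "0 \<le> e" using g_le L2_set_nonneg order_trans by blast
    have ak: "0 < \<alpha> k" by (rule step_pos)
    have unroll: "y (k + n) i = y k i - (\<Sum>l<n. \<alpha> (k + l) * laplacian N (A (k + l)) (y (k + l)) i)
        + (\<Sum>l<n. \<alpha> (k + l) * g (k + l) i)" if "i < N" for n i
      by (induction n) (simp_all add: rec[OF that])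
    have lapW: "laplacian N W f i = (\<Sum>l<L. \<alpha> (k + l) * laplacian N (A (k + l)) f i)" for f i
      unfolding laplacian_def W_def sum_distrib_left sum_distrib_right
      by (subst sum.swap) (simp add: mult.assoc)
    \<comment> \<open>Each Laplacian of \<open>y (k + l)\<close> is split into the Laplacian of
      \<open>y k\<close>, collected in W, and that of the difference, which
      \<open>window_drift\<close> controls.\<close>
    have "nrm N (y (k + L)) = nrm N (\<lambda>i. (y k i - laplacian N W (y k) i)
        + ((\<Sum>l<L. \<alpha> (k + l) * g (k + l) i)
        - (\<Sum>l<L. \<alpha> (k + l) * laplacian N (A (k + l)) (\<lambda>i. y (k + l) i - y k i) i)))"
      by (intro L2_set_cong refl)
        (simp add: unroll[where n = L] lapW laplacian_diff right_diff_distrib sum_subtractf)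
    also have "\<dots> \<le> nrm N (\<lambda>i. y k i - laplacian N W (y k) i)
        + nrm N (\<lambda>i. (\<Sum>l<L. \<alpha> (k + l) * g (k + l) i)
        - (\<Sum>l<L. \<alpha> (k + l) * laplacian N (A (k + l)) (\<lambda>i. y (k + l) i - y k i) i))"
      by (rule L2_set_triangle_ineq)
    also have "\<dots> \<le> nrm N (\<lambda>i. y k i - laplacian N W (y k) i)
        + (nrm N (\<lambda>i. \<Sum>l<L. \<alpha> (k + l) * g (k + l) i)
        + nrm N (\<lambda>i. \<Sum>l<L. \<alpha> (k + l) * laplacian N (A (k + l)) (\<lambda>i. y (k + l) i - y k i) i))"
      by (intro add_left_mono nrm_diff_le)
    also have "\<dots> \<le> (1 - c * \<alpha> k) * nrm N (y k)
        + (real L * \<alpha> k * e + S * \<alpha> k * (\<alpha> k * (nrm N (y k) + e)))"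
    proof (intro add_mono)
      show "nrm N (\<lambda>i. y k i - laplacian N W (y k) i) \<le> (1 - c * \<alpha> k) * nrm N (y k)"
        unfolding c_def
      proof (rule laplacian_contraction[OF N1 conn[of k] zero, where K = "real L * K"])
        fix i j assume ij: "i < N" "j < N"
        show "W i j = W j i" unfolding W_def using sym ij by simp
        have "0 \<le> W i j" unfolding W_def
          using A_bounds[OF ij] step_pos by (intro sum_nonneg mult_nonneg_nonneg) (auto intro: less_imp_le)
        moreover have "W i j \<le> (\<Sum>l<L. \<alpha> k * K)" unfolding W_def
          using A_bounds[OF ij] step_pos step_antimono K0
          by (intro sum_mono mult_mono) (auto intro: less_imp_le)
        ultimately show "0 \<le> W i j \<and> W i j \<le> \<alpha> k * (real L * K)" by (simp add: mult_ac)
        assume "\<exists>l\<in>{k..<k + L}. b \<le> A l i j"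
        then obtain l where l: "k \<le> l" "l < k + L" "b \<le> A l i j" by auto
        \<comment> \<open>The edge may be active at any time l of the window; its single term in W
          already suffices, since
          \<open>\<alpha> l \<ge> \<alpha> (k + L) \<ge> \<alpha> k / P\<close>.\<close>
        have "\<alpha> k * (b / P) \<le> \<alpha> (k + L) * b"
          using ratio b0 P by (simp add: field_simps)
        also have "\<dots> \<le> \<alpha> l * A l i j"
          using l step_pos b0 step_antimono[of l "k + L"] by (intro mult_mono) (auto intro: less_imp_le)
        also have "\<dots> = \<alpha> (k + (l - k)) * A (k + (l - k)) i j" using l by simp
        also have "\<dots> \<le> W i j" unfolding W_def
          using l A_bounds[OF ij] step_pos
          by (intro member_le_sum[where f = "\<lambda>l. \<alpha> (k + l) * A (k + l) i j"])
            (auto intro: less_imp_le mult_nonneg_nonneg)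
        finally show "\<alpha> k * (b / P) \<le> W i j" .
      qed (use b0 P ak small1 small2 in \<open>auto simp: c_def\<close>)
    next
      have "nrm N (\<lambda>i. \<Sum>l<L. \<alpha> (k + l) * g (k + l) i) \<le> (\<Sum>l<L. nrm N (\<lambda>i. \<alpha> (k + l) * g (k + l) i))"
        by (rule nrm_sum_le)
      also have "\<dots> \<le> (\<Sum>l<L. \<alpha> k * e)"
        using g_le step_pos step_antimono by (intro sum_mono) (auto simp: nrm_scale less_imp_le L2_set_nonneg intro!: mult_mono)
      finally show "nrm N (\<lambda>i. \<Sum>l<L. \<alpha> (k + l) * g (k + l) i) \<le> real L * \<alpha> k * e" by simp
    next
      have "nrm N (\<lambda>i. \<Sum>l<L. \<alpha> (k + l) * laplacian N (A (k + l)) (\<lambda>i. y (k + l) i - y k i) i)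
          \<le> (\<Sum>l<L. nrm N (\<lambda>i. \<alpha> (k + l) * laplacian N (A (k + l)) (\<lambda>i. y (k + l) i - y k i) i))"
        by (rule nrm_sum_le)
      also have "\<dots> \<le> (\<Sum>l<L. \<alpha> k * (C * (D l * \<alpha> k * (nrm N (y k) + e))))"
      proof (rule sum_mono)
        fix l assume "l \<in> {..<L}"
        have "nrm N (laplacian N (A (k + l)) (\<lambda>i. y (k + l) i - y k i))
            \<le> C * nrm N (\<lambda>i. y (k + l) i - y k i)" unfolding C_def by (rule nrm_lap_le)
        also have "\<dots> \<le> C * (D l * \<alpha> k * (nrm N (y k) + e))"
          using D[OF g_le] C by (intro mult_left_mono)
        finally show "nrm N (\<lambda>i. \<alpha> (k + l) * laplacian N (A (k + l)) (\<lambda>i. y (k + l) i - y k i) i)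
            \<le> \<alpha> k * (C * (D l * \<alpha> k * (nrm N (y k) + e)))"
          using step_pos step_antimono[of k "k + l"]
          by (auto simp: nrm_scale less_imp_le L2_set_nonneg intro!: mult_mono)
      qed
      also have "\<dots> = S * \<alpha> k * (\<alpha> k * (nrm N (y k) + e))"
        by (simp add: S_def sum_distrib_left sum_distrib_right mult_ac)
      finally show "nrm N (\<lambda>i. \<Sum>l<L. \<alpha> (k + l) * laplacian N (A (k + l)) (\<lambda>i. y (k + l) i - y k i) i)
          \<le> S * \<alpha> k * (\<alpha> k * (nrm N (y k) + e))" .
    qed
    also have "\<dots> = (1 - c * \<alpha> k) * nrm N (y k) + S * \<alpha> k * (\<alpha> k * nrm N (y k))
        + (real L * \<alpha> k * e + S * \<alpha> k * (\<alpha> k * e))" by (simp add: algebra_simps)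
    also have "\<dots> \<le> (1 - c * \<alpha> k) * nrm N (y k) + c / 2 * (\<alpha> k * nrm N (y k))
        + (real L * \<alpha> k * e + S * \<alpha> 0 * (\<alpha> k * e))"
      using small3 ak e S step_antimono[of 0 k]
      by (intro add_mono order_refl mult_right_mono mult_left_mono) (auto simp: L2_set_nonneg)
    finally show ?thesis by (simp add: algebra_simps)
  qed
  show "(\<lambda>m. nrm N (y (m * L + r))) \<longlonglongrightarrow> 0"
  proof (rule perturbed_contraction_tendsto_0[where a = "\<lambda>m. c / 2 * \<alpha> (m * L + r)"])
    show "filterlim (\<lambda>n. \<Sum>m<n. c / 2 * \<alpha> (m * L + r)) at_top sequentially"
      unfolding sum_distrib_left[symmetric]
      using c by (intro filterlim_tendsto_pos_mult_at_top[OF tendsto_const _ step_subsequence_diverges]) auto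
  next
    fix e :: real assume e: "0 < e"
    \<comment> \<open>Chosen so that the error of \<open>window\<close> equals
      \<open>c / 2 * \<alpha> k * e\<close>, the form required by
      \<open>perturbed_contraction_tendsto_0\<close> with rate
      \<open>c / 2 * \<alpha> k\<close>.\<close>
    define e' where "e' = c / 2 * e / (real L + S * \<alpha> 0)"
    have den: "0 < real L + S * \<alpha> 0" using L0 S step_pos[of 0] by (intro add_pos_nonneg) auto
    have e': "0 < e'" using e c den by (simp add: e'_def)
    have small: "\<forall>\<^sub>F k in sequentially. q * \<alpha> k \<le> t" if "0 < t" for q t
    proof -
      have "(\<lambda>k. q * \<alpha> k) \<longlonglongrightarrow> 0" using step_null by (rule tendsto_mult_right_zero)
      then have "\<forall>\<^sub>F k in sequentially. q * \<alpha> k < t" using that by (rule order_tendstoD)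
      then show ?thesis by (rule eventually_mono) simp
    qed
    have "\<forall>\<^sub>F k in sequentially. nrm N (g k) < e'" using g e' by (rule order_tendstoD)
    then have "\<forall>\<^sub>F k in sequentially. \<forall>l\<ge>k. nrm N (g l) \<le> e'"
      unfolding eventually_sequentially by (meson le_trans less_imp_le)
    moreover have "\<forall>\<^sub>F k in sequentially. \<alpha> k \<le> P * \<alpha> (k + L)"
      unfolding P_def by (rule step_window_le)
    moreover have "\<forall>\<^sub>F k in sequentially. 4 * (real L * K)\<^sup>2 * real N ^ 4 * \<alpha> k \<le> b / P / (2 * real N ^ 5)"
      using b0 P N1 by (intro small) simp
    moreover have "\<forall>\<^sub>F k in sequentially. c * \<alpha> k \<le> 1" by (intro small) simp
    moreover have "\<forall>\<^sub>F k in sequentially. S * \<alpha> k \<le> c / 2" using c by (intro small) simp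
    ultimately have ev: "\<forall>\<^sub>F k in sequentially. c / 2 * \<alpha> k \<le> 1 \<and>
        nrm N (y (k + L)) \<le> (1 - c / 2 * \<alpha> k) * nrm N (y k) + c / 2 * \<alpha> k * e"
    proof eventually_elim
      case (elim k)
      have eq: "\<alpha> k * (real L + S * \<alpha> 0) * e' = c / 2 * \<alpha> k * e"
        using den by (simp add: e'_def field_simps)
      have "0 \<le> c * \<alpha> k" using c step_pos[of k] by simp
      then have "c / 2 * \<alpha> k \<le> 1" using elim(4) by linarith
      then show ?case using window[OF elim] unfolding eq by blast
    qed
    have "filterlim (\<lambda>m. m * L + r) sequentially sequentially"
      using L0 by (intro filterlim_subseq) (auto simp: strict_mono_def)
    from eventually_compose_filterlim[OF ev this]
    show "\<forall>\<^sub>F m in sequentially. c / 2 * \<alpha> (m * L + r) \<le> 1 \<and>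
        nrm N (y (Suc m * L + r)) \<le> (1 - c / 2 * \<alpha> (m * L + r)) * nrm N (y (m * L + r))
          + c / 2 * \<alpha> (m * L + r) * e"
      by (simp add: add_ac)
  qed (rule L2_set_nonneg)
qed

text \<open>Adding the tails of the perturbation series to the state turns the perturbation into
  one that acts only through the Laplacian, so that the mean becomes constant.\<close>

theorem perturbed_consensus:
  assumes rec: "\<And>k i. i < N \<Longrightarrow>
      x (Suc k) i = x k i - \<alpha> k * laplacian N (A k) (x k) i + w k i"
    and w: "\<And>i. i < N \<Longrightarrow> summable (\<lambda>k. w k i)"
  shows "\<exists>c. \<forall>i<N. (\<lambda>k. x k i) \<longlonglongrightarrow> c"
proof -
  define R where "R k i = (\<Sum>l. w (l + k) i)" for k i
  have R_Suc: "R k i = w k i + R (Suc k) i" if "i < N" for k i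
    using suminf_split_head[OF summable_ignore_initial_segment[OF w[OF that], of k]]
    by (simp add: R_def)
  have R_lim: "(\<lambda>k. R k i) \<longlonglongrightarrow> 0" if "i < N" for i
  proof -
    have "R k i = (\<Sum>l. w l i) - (\<Sum>l<k. w l i)" for k
      unfolding R_def by (rule suminf_minus_initial_segment[OF w[OF that]])
    moreover have "(\<lambda>k. (\<Sum>l. w l i) - (\<Sum>l<k. w l i)) \<longlonglongrightarrow> (\<Sum>l. w l i) - (\<Sum>l. w l i)"
      by (intro tendsto_diff tendsto_const summable_LIMSEQ w that)
    ultimately show ?thesis by simp
  qed
  \<comment> \<open>The prospective limit: the mean of \<open>x + R\<close>, which is conserved
    because the tail R gives up exactly the \<open>w k i\<close> that x receives.\<close>
  define c where "c = (\<Sum>i<N. x 0 i + R 0 i) / real N"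
  define y where "y k i = x k i + R k i - c" for k i
  \<comment> \<open>The Laplacian ignores the constant c, so rewriting that of x through y leaves
    only the Laplacian of R, which vanishes along with the tails.\<close>
  define g where "g k = laplacian N (A k) (R k)" for k
  have lap_y: "laplacian N (A k) (y k) i = laplacian N (A k) (x k) i + g k i" for k i
    unfolding laplacian_def g_def y_def sum.distrib[symmetric]
    by (rule sum.cong) (auto simp: algebra_simps)
  have y_rec: "y (Suc k) i = y k i - \<alpha> k * laplacian N (A k) (y k) i + \<alpha> k * g k i" if "i < N" for k i
    unfolding lap_y by (simp add: y_def rec[OF that] R_Suc[OF that, of k] algebra_simps)
  have y_zero: "(\<Sum>i<N. y k i) = 0" for k
  proof (induction k)
    case 0
    then show ?case using N1 by (simp add: y_def c_def sum_subtractf)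
  next
    case (Suc k)
    have "(\<Sum>i<N. y (Suc k) i) = (\<Sum>i<N. y k i) - \<alpha> k * (\<Sum>i<N. laplacian N (A k) (y k) i)
        + \<alpha> k * (\<Sum>i<N. g k i)"
      by (simp add: y_rec sum.distrib sum_subtractf sum_distrib_left)
    then show ?case using Suc by (simp add: sum_laplacian sym g_def)
  qed
  have nR: "(\<lambda>k. nrm N (R k)) \<longlonglongrightarrow> 0"
  proof -
    have "(\<lambda>k. \<Sum>i<N. (R k i)\<^sup>2) \<longlonglongrightarrow> (\<Sum>i<N. 0\<^sup>2)"
      by (intro tendsto_sum tendsto_power R_lim) auto
    then have "(\<lambda>k. sqrt (\<Sum>i<N. (R k i)\<^sup>2)) \<longlonglongrightarrow> sqrt (\<Sum>i<N. 0\<^sup>2)"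
      by (rule tendsto_real_sqrt)
    then show ?thesis by (simp add: L2_set_def)
  qed
  have "(\<lambda>k. nrm N (g k)) \<longlonglongrightarrow> 0"
  proof (rule tendsto_sandwich[OF _ _ tendsto_const])
    show "\<forall>\<^sub>F k in sequentially. nrm N (g k) \<le> 2 * K * (real N)\<^sup>2 * nrm N (R k)"
      unfolding g_def by (simp add: nrm_lap_le)
    show "(\<lambda>k. 2 * K * (real N)\<^sup>2 * nrm N (R k)) \<longlonglongrightarrow> 0"
      using nR by (rule tendsto_mult_right_zero)
  qed (simp add: L2_set_nonneg)
  then have y_lim: "(\<lambda>k. nrm N (y k)) \<longlonglongrightarrow> 0"
    using y_rec y_zero by (intro disagreement_vanishes[of y g]) auto
  have "(\<lambda>k. x k i) \<longlonglongrightarrow> c" if "i < N" for i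
  proof -
    have "(\<lambda>k. y k i) \<longlonglongrightarrow> 0"
    proof (rule Lim_null_comparison[OF always_eventually y_lim], rule allI)
      fix k
      show "norm (y k i) \<le> nrm N (y k)"
        using member_le_L2_set[of "{..<N}" i "\<lambda>i. \<bar>y k i\<bar>"] that by (simp add: L2_set_def)
    qed
    then have "(\<lambda>k. y k i - R k i + c) \<longlonglongrightarrow> 0 - 0 + c"
      by (intro tendsto_intros R_lim that)
    then show ?thesis by (simp add: y_def)
  qed
  then show ?thesis by blast
qed

end

subsection \<open>Square-integrable functions\<close>

lemma integrable_mult_of_squares:
  fixes f g :: "'a \<Rightarrow> real"
  assumes "f \<in> borel_measurable M" "g \<in> borel_measurable M"
    and "integrable M (\<lambda>x. (f x)\<^sup>2)" "integrable M (\<lambda>x. (g x)\<^sup>2)"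
  shows "integrable M (\<lambda>x. f x * g x)"
proof (rule Bochner_Integration.integrable_bound)
  show "integrable M (\<lambda>x. (f x)\<^sup>2 + (g x)\<^sup>2)" using assms by simp
  show "(\<lambda>x. f x * g x) \<in> borel_measurable M" using assms by simp
  have "\<bar>a * b\<bar> \<le> a\<^sup>2 + b\<^sup>2" for a b :: real
  proof -
    have "2 * (\<bar>a\<bar> * \<bar>b\<bar>) \<le> a\<^sup>2 + b\<^sup>2" using sum_squares_bound[of "\<bar>a\<bar>" "\<bar>b\<bar>"] by simp
    moreover have "0 \<le> \<bar>a\<bar> * \<bar>b\<bar>" by simp
    ultimately show ?thesis unfolding abs_mult by linarith
  qed
  then show "AE x in M. norm (f x * g x) \<le> norm ((f x)\<^sup>2 + (g x)\<^sup>2)" by simp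
qed

lemma integrable_square_add:
  fixes f g :: "'a \<Rightarrow> real"
  assumes "f \<in> borel_measurable M" "g \<in> borel_measurable M"
    and "integrable M (\<lambda>x. (f x)\<^sup>2)" "integrable M (\<lambda>x. (g x)\<^sup>2)"
  shows "integrable M (\<lambda>x. (f x + g x)\<^sup>2)"
  using assms integrable_mult_of_squares[OF assms] by (simp add: power2_sum mult.assoc)

lemma integrable_square_cmult:
  fixes f :: "'a \<Rightarrow> real"
  assumes "integrable M (\<lambda>x. (f x)\<^sup>2)"
  shows "integrable M (\<lambda>x. (c * f x)\<^sup>2)"
  using assms by (simp add: power_mult_distrib)

lemma integrable_square_sum:
  fixes f :: "'i \<Rightarrow> 'a \<Rightarrow> real"
  assumes "finite I" and "\<And>i. i \<in> I \<Longrightarrow> f i \<in> borel_measurable M"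
    and "\<And>i. i \<in> I \<Longrightarrow> integrable M (\<lambda>x. (f i x)\<^sup>2)"
  shows "integrable M (\<lambda>x. (\<Sum>i\<in>I. f i x)\<^sup>2)"
  using assms by (induction I rule: finite_induct) (auto intro!: integrable_square_add)

lemma (in finite_measure) integrable_of_square:
  fixes f :: "'a \<Rightarrow> real"
  assumes "f \<in> borel_measurable M" and "integrable M (\<lambda>x. (f x)\<^sup>2)"
  shows "integrable M f"
  using integrable_mult_of_squares[OF assms(1) _ assms(2), of "\<lambda>_. 1"] by simp

lemma integral_indicator_square_le:
  fixes f :: "'a \<Rightarrow> real"
  assumes "f \<in> borel_measurable M" "integrable M (\<lambda>x. (f x)\<^sup>2)" "Measurable.pred M T"
  shows "integrable M (\<lambda>x. ((if T x then 1 else 0) * f x)\<^sup>2)"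
    and "(\<integral>x. ((if T x then 1 else 0) * f x)\<^sup>2 \<partial>M) \<le> (\<integral>x. (f x)\<^sup>2 \<partial>M)"
proof -
  have [measurable]: "f \<in> borel_measurable M" "Measurable.pred M T" by fact+
  show i: "integrable M (\<lambda>x. ((if T x then 1 else 0) * f x)\<^sup>2)"
    by (rule Bochner_Integration.integrable_bound[OF assms(2)]) auto
  show "(\<integral>x. ((if T x then 1 else 0) * f x)\<^sup>2 \<partial>M) \<le> (\<integral>x. (f x)\<^sup>2 \<partial>M)"
    by (rule integral_mono[OF i assms(2)]) auto
qed

text \<open>By monotone convergence the sum has finite expectation and is therefore almost surely
  finite.\<close>

lemma AE_summable_of_integrals:
  fixes f :: "nat \<Rightarrow> 'a \<Rightarrow> real"
  assumes int: "\<And>n. integrable M (f n)" and nonneg: "\<And>n x. x \<in> space M \<Longrightarrow> 0 \<le> f n x"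
    and bounded: "\<And>n. (\<Sum>k<n. \<integral>x. f k x \<partial>M) \<le> C"
  shows "AE x in M. summable (\<lambda>n. f n x)"
proof -
  have [measurable]: "f n \<in> borel_measurable M" for n using int by auto
  have eq: "(\<integral>\<^sup>+x. ennreal (f n x) \<partial>M) = ennreal (\<integral>x. f n x \<partial>M)" for n
    using int nonneg by (intro nn_integral_eq_integral) auto
  have "summable (\<lambda>n. \<integral>x. f n x \<partial>M)"
    by (rule summableI_nonneg_bounded[OF _ bounded]) (auto intro!: Bochner_Integration.integral_nonneg nonneg)
  then have "(\<integral>\<^sup>+x. (\<Sum>n. ennreal (f n x)) \<partial>M) < \<infinity>"
    by (simp add: nn_integral_suminf eq suminf_ennreal2 Bochner_Integration.integral_nonneg nonneg)
  then have "AE x in M. (\<Sum>n. ennreal (f n x)) \<noteq> \<infinity>"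
    by (intro nn_integral_PInf_AE) auto
  then show ?thesis
  proof (rule AE_mp, intro AE_I2 impI)
    fix x assume x: "x \<in> space M" and fin: "(\<Sum>n. ennreal (f n x)) \<noteq> \<infinity>"
    show "summable (\<lambda>n. f n x)"
      using fin nonneg[OF x] by (intro summable_suminf_not_top) auto
  qed
qed

subsection \<open>Convergence of square-integrable martingales\<close>

text \<open>The martingale property is phrased as orthogonality to every square-integrable function
  of the past. This is what independence delivers and what the variance computation consumes, so
  conditional expectations do not appear. The increment \<open>d n\<close> becomes known at time
  \<open>n + 1\<close>.\<close>

locale square_integrable_martingale_difference = prob_space M for M :: "'a measure" +
  fixes F :: "nat \<Rightarrow> 'a measure" and d :: "nat \<Rightarrow> 'a \<Rightarrow> real"
  assumes sub: "\<And>n. subalgebra M (F n)"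
    and filtration: "\<And>n. sets (F n) \<subseteq> sets (F (Suc n))"
    and adapted: "\<And>n. d n \<in> borel_measurable (F (Suc n))"
    and square_integrable: "\<And>n. integrable M (\<lambda>\<omega>. (d n \<omega>)\<^sup>2)"
    and orthogonal: "\<And>n G. G \<in> borel_measurable (F n) \<Longrightarrow> integrable M (\<lambda>\<omega>. (G \<omega>)\<^sup>2) \<Longrightarrow>
      (\<integral>\<omega>. G \<omega> * d n \<omega> \<partial>M) = 0"
    and summable_variances: "summable (\<lambda>n. \<integral>\<omega>. (d n \<omega>)\<^sup>2 \<partial>M)"
begin

definition S :: "nat \<Rightarrow> 'a \<Rightarrow> real" where
  "S n \<omega> = (\<Sum>k<n. d k \<omega>)"

lemma filtration_le: "m \<le> n \<Longrightarrow> sets (F m) \<subseteq> sets (F n)"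
  using filtration by (rule lift_Suc_mono_le)

lemma measurable_F_mono:
  assumes "f \<in> borel_measurable (F m)" "m \<le> n"
  shows "f \<in> borel_measurable (F n)"
  using assms filtration_le[OF assms(2)] sub[of m] sub[of n]
  by (auto simp: measurable_def subalgebra_def)

lemma F_measurable_M: "f \<in> borel_measurable (F n) \<Longrightarrow> f \<in> borel_measurable M"
  by (rule measurable_from_subalg[OF sub])

lemma d_measurable [measurable]: "d n \<in> borel_measurable M"
  using adapted by (rule F_measurable_M)

lemma S_adapted: "m \<le> n \<Longrightarrow> S m \<in> borel_measurable (F n)"
  unfolding S_def by (intro borel_measurable_sum measurable_F_mono[OF adapted]) auto

lemma S_measurable [measurable]: "S n \<in> borel_measurable M"
  using S_adapted[of n n] by (intro F_measurable_M) auto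

definition before_exit :: "real \<Rightarrow> nat \<Rightarrow> nat \<Rightarrow> 'a \<Rightarrow> bool" where
  "before_exit c m n \<omega> \<longleftrightarrow> (\<forall>j\<in>{m..n}. \<bar>S j \<omega> - S m \<omega>\<bar> < c)"

text \<open>The increments after time m, frozen at the first exit from the band of width c. Whether
  the k-th increment counts is decided by \<open>F k\<close>, before that increment is
  revealed.\<close>

definition stopped :: "real \<Rightarrow> nat \<Rightarrow> nat \<Rightarrow> 'a \<Rightarrow> real" where
  "stopped c m n \<omega> = (\<Sum>k=m..<n. (if before_exit c m k \<omega> then 1 else 0) * d k \<omega>)"

lemma before_exit_adapted: "m \<le> n \<Longrightarrow> Measurable.pred (F n) (before_exit c m n)"
proof -
  assume "m \<le> n"
  then show ?thesis
    unfolding before_exit_def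
    by (intro pred_intros_finite borel_measurable_pred_less borel_measurable_abs
        borel_measurable_diff borel_measurable_const S_adapted) auto
qed

lemma stopped_adapted: "m \<le> n \<Longrightarrow> stopped c m n \<in> borel_measurable (F n)"
  unfolding stopped_def
proof (intro borel_measurable_sum borel_measurable_times)
  fix k assume k: "k \<in> {m..<n}"
  then have [measurable]: "Measurable.pred (F k) (before_exit c m k)"
    by (intro before_exit_adapted) auto
  show "(\<lambda>\<omega>. if before_exit c m k \<omega> then 1 else 0) \<in> borel_measurable (F n)"
    by (rule measurable_F_mono[of _ k]) (use k in auto)
  show "d k \<in> borel_measurable (F n)"
    using k by (intro measurable_F_mono[OF adapted]) auto
qed

text \<open>The next increment is multiplied by a factor T with values 0 and 1 that is measurable
  for \<open>F n\<close>. So the cross term vanishes by orthogonality to \<open>N * T\<close>, and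
  the variances add up.\<close>

lemma stopped_square:
  assumes "m \<le> n"
  shows "integrable M (\<lambda>\<omega>. (stopped c m n \<omega>)\<^sup>2) \<and>
    (\<integral>\<omega>. (stopped c m n \<omega>)\<^sup>2 \<partial>M) \<le> (\<Sum>k=m..<n. \<integral>\<omega>. (d k \<omega>)\<^sup>2 \<partial>M)"
  using assms
proof (induction n rule: dec_induct)
  case base
  then show ?case by (simp add: stopped_def)
next
  case (step n)
  define T :: "'a \<Rightarrow> real" where "T \<omega> = (if before_exit c m n \<omega> then 1 else 0)" for \<omega>
  define N where "N = stopped c m n"
  have pF: "Measurable.pred (F n) (before_exit c m n)" using step by (intro before_exit_adapted) auto
  have TF [measurable]: "T \<in> borel_measurable (F n)" unfolding T_def using pF by measurable
  have pM: "Measurable.pred M (before_exit c m n)" by (rule measurable_from_subalg[OF sub pF])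
  have NF [measurable]: "N \<in> borel_measurable (F n)" unfolding N_def using step by (intro stopped_adapted)
  have NTF: "(\<lambda>\<omega>. N \<omega> * T \<omega>) \<in> borel_measurable (F n)" by measurable
  have [measurable]: "N \<in> borel_measurable M" "T \<in> borel_measurable M"
    using F_measurable_M[OF NF] F_measurable_M[OF TF] by auto
  have N2: "integrable M (\<lambda>\<omega>. (N \<omega>)\<^sup>2)" using step.IH by (simp add: N_def)
  have Td: "integrable M (\<lambda>\<omega>. (T \<omega> * d n \<omega>)\<^sup>2)"
      "(\<integral>\<omega>. (T \<omega> * d n \<omega>)\<^sup>2 \<partial>M) \<le> (\<integral>\<omega>. (d n \<omega>)\<^sup>2 \<partial>M)"
    unfolding T_def by (rule integral_indicator_square_le[OF d_measurable square_integrable pM])+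
  have NT2: "integrable M (\<lambda>\<omega>. (N \<omega> * T \<omega>)\<^sup>2)"
  proof (rule Bochner_Integration.integrable_bound[OF N2])
    show "(\<lambda>\<omega>. (N \<omega> * T \<omega>)\<^sup>2) \<in> borel_measurable M" by measurable
  qed (auto simp: T_def)
  have cross: "integrable M (\<lambda>\<omega>. N \<omega> * (T \<omega> * d n \<omega>))"
    by (intro integrable_mult_of_squares N2 Td) auto
  have cross0: "(\<integral>\<omega>. N \<omega> * (T \<omega> * d n \<omega>) \<partial>M) = 0"
    using orthogonal[OF NTF NT2] by (simp add: mult.assoc)
  have eq: "(stopped c m (Suc n) \<omega>)\<^sup>2 =
      (N \<omega>)\<^sup>2 + 2 * (N \<omega> * (T \<omega> * d n \<omega>)) + (T \<omega> * d n \<omega>)\<^sup>2" for \<omega>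
    using step(1) by (simp add: stopped_def N_def T_def power2_sum algebra_simps)
  show ?case
    unfolding eq using N2 Td cross cross0 step by (auto simp: N_def)
qed

text \<open>At the exit the stopped sum already lies outside the band, and it stays there because
  all later increments are switched off.\<close>

lemma stopped_cases:
  assumes "m \<le> n" "0 < c"
  shows "if before_exit c m n \<omega> then stopped c m n \<omega> = S n \<omega> - S m \<omega>
    else c \<le> \<bar>stopped c m n \<omega>\<bar>"
  using assms(1)
proof (induction n rule: dec_induct)
  case base
  then show ?case using assms(2) by (simp add: before_exit_def stopped_def)
next
  case (step n)
  have "before_exit c m (Suc n) \<omega> \<longleftrightarrow> before_exit c m n \<omega> \<and> \<bar>S (Suc n) \<omega> - S m \<omega>\<bar> < c"
    using step(1) by (auto simp: before_exit_def le_Suc_eq)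
  moreover have "stopped c m (Suc n) \<omega> =
      stopped c m n \<omega> + (if before_exit c m n \<omega> then 1 else 0) * d n \<omega>"
    using step(1) by (simp add: stopped_def)
  ultimately show ?case using step.IH by (auto simp: S_def split: if_splits)
qed

lemma pred_before_exit [measurable]: "Measurable.pred M (before_exit c m n)"
  unfolding before_exit_def by measurable

text \<open>Kolmogorov's maximal inequality, obtained as Chebyshev's inequality for the stopped
  sum.\<close>

lemma exit_prob_le:
  assumes "m \<le> n" "0 < c"
  shows "prob {\<omega>\<in>space M. \<not> before_exit c m n \<omega>} \<le> (\<Sum>k=m..<n. \<integral>\<omega>. (d k \<omega>)\<^sup>2 \<partial>M) / c\<^sup>2"
proof -
  let ?A = "{\<omega>\<in>space M. \<not> before_exit c m n \<omega>}"
  have [measurable]: "?A \<in> events" by measurable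
  have "c\<^sup>2 * prob ?A = (\<integral>\<omega>. c\<^sup>2 * indicator ?A \<omega> \<partial>M)" by simp
  also have "\<dots> \<le> (\<integral>\<omega>. (stopped c m n \<omega>)\<^sup>2 \<partial>M)"
  proof (rule integral_mono)
    show "integrable M (\<lambda>\<omega>. c\<^sup>2 * indicator ?A \<omega>)"
      by (intro integrable_mult_right integrable_real_indicator) (auto simp: less_top[symmetric])
    show "integrable M (\<lambda>\<omega>. (stopped c m n \<omega>)\<^sup>2)" using stopped_square[OF assms(1)] by blast
    fix \<omega>
    show "c\<^sup>2 * indicator ?A \<omega> \<le> (stopped c m n \<omega>)\<^sup>2"
    proof (cases "before_exit c m n \<omega>")
      case False
      then have "c \<le> \<bar>stopped c m n \<omega>\<bar>" using stopped_cases[OF assms, of \<omega>] by simp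
      then have "c\<^sup>2 \<le> (stopped c m n \<omega>)\<^sup>2"
        using assms(2) by (metis abs_le_square_iff abs_of_pos)
      then show ?thesis by (simp add: indicator_def)
    qed simp
  qed
  also have "\<dots> \<le> (\<Sum>k=m..<n. \<integral>\<omega>. (d k \<omega>)\<^sup>2 \<partial>M)" using stopped_square[OF assms(1)] by blast
  finally show ?thesis using assms(2) by (simp add: field_simps)
qed

text \<open>The maximal inequality bounds the probability of ever leaving the band after time m by a
  tail of the variance series divided by \<open>c\<^sup>2\<close>, and this tends to zero with
  m.\<close>

lemma AE_eventually_close:
  assumes c: "0 < c"
  shows "AE \<omega> in M. \<exists>m. \<forall>n\<ge>m. \<bar>S n \<omega> - S m \<omega>\<bar> < c"
proof -
  define v where "v k = (\<integral>\<omega>. (d k \<omega>)\<^sup>2 \<partial>M)" for k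
  have v: "summable v" "\<And>k. 0 \<le> v k" using summable_variances by (auto simp: v_def[abs_def])
  define B where "B m n = {\<omega>\<in>space M. \<not> before_exit c m (m + n) \<omega>}" for m n
  have B [measurable]: "B m n \<in> events" for m n unfolding B_def by measurable
  \<comment> \<open>A longer horizon makes an exit more likely, so continuity from below carries the
    bound from finite horizons to the union.\<close>
  have incB: "incseq (B m)" for m
    unfolding incseq_def B_def before_exit_def by fastforce
  have "prob (\<Union>n. B m n) \<le> (\<Sum>k. v (k + m)) / c\<^sup>2" for m
  proof (rule LIMSEQ_le_const2[OF finite_Lim_measure_incseq[OF _ incB]])
    show "range (B m) \<subseteq> events" by auto
    show "\<exists>N. \<forall>n\<ge>N. prob (B m n) \<le> (\<Sum>k. v (k + m)) / c\<^sup>2"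
    proof (intro exI allI impI)
      fix n :: nat
      have "prob (B m n) \<le> (\<Sum>k=m..<m + n. v k) / c\<^sup>2"
        unfolding B_def v_def using c by (intro exit_prob_le) auto
      also have "(\<Sum>k=m..<m + n. v k) = (\<Sum>k<n. v (k + m))"
        using sum.shift_bounds_nat_ivl[of v 0 m n] by (simp add: atLeast0LessThan add.commute)
      also have "\<dots> \<le> (\<Sum>k. v (k + m))"
        using v by (intro sum_le_suminf summable_ignore_initial_segment) auto
      finally show "prob (B m n) \<le> (\<Sum>k. v (k + m)) / c\<^sup>2" using c by (simp add: divide_right_mono)
    qed
  qed
  then have le: "prob (\<Inter>m. \<Union>n. B m n) \<le> (\<Sum>k. v (k + m)) / c\<^sup>2" for m
    using finite_measure_mono[of "\<Inter>m. \<Union>n. B m n" "\<Union>n. B m n"] by (meson B INT_lower UNIV_I order_trans sets.countable_UN'' countableI_type)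
  have "(\<lambda>m. (\<Sum>k. v (k + m)) / c\<^sup>2) \<longlonglongrightarrow> 0 / c\<^sup>2"
    using suminf_exist_split2[OF v(1)] c by (intro tendsto_divide tendsto_const) auto
  then have "prob (\<Inter>m. \<Union>n. B m n) \<le> 0"
    using le by (intro LIMSEQ_le_const[of _ 0]) auto
  then have "prob (\<Inter>m. \<Union>n. B m n) = 0" by (simp add: measure_le_0_iff)
  moreover have "(\<Inter>m. \<Union>n. B m n) \<in> events" by measurable
  ultimately have "(\<Inter>m. \<Union>n. B m n) \<in> null_sets M"
    by (simp add: null_sets_def emeasure_eq_measure)
  then show ?thesis
  proof (rule AE_I')
    show "{\<omega>\<in>space M. \<not> (\<exists>m. \<forall>n\<ge>m. \<bar>S n \<omega> - S m \<omega>\<bar> < c)} \<subseteq> (\<Inter>m. \<Union>n. B m n)"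
    proof safe
      fix \<omega> m assume w: "\<omega> \<in> space M" and "\<nexists>m. \<forall>n\<ge>m. \<bar>S n \<omega> - S m \<omega>\<bar> < c"
      then obtain n where "m \<le> n" "\<not> \<bar>S n \<omega> - S m \<omega>\<bar> < c" by blast
      then have "\<omega> \<in> B m (n - m)" using w by (auto simp: B_def before_exit_def)
      then show "\<omega> \<in> (\<Union>n. B m n)" by blast
    qed
  qed
qed

theorem AE_summable: "AE \<omega> in M. summable (\<lambda>n. d n \<omega>)"
proof -
  have "AE \<omega> in M. \<forall>r::nat. \<exists>m. \<forall>n\<ge>m. \<bar>S n \<omega> - S m \<omega>\<bar> < 1 / real (Suc r)"
    unfolding AE_all_countable by (intro allI AE_eventually_close) simp
  then show ?thesis
  proof (rule AE_mp, intro AE_I2 impI)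
    fix \<omega> assume *: "\<forall>r::nat. \<exists>m. \<forall>n\<ge>m. \<bar>S n \<omega> - S m \<omega>\<bar> < 1 / real (Suc r)"
    have "Cauchy (\<lambda>n. S n \<omega>)"
    proof (rule metric_CauchyI)
      fix e :: real assume "0 < e"
      then obtain r :: nat where r: "1 / real (Suc r) < e / 2"
        using nat_approx_posE[of "e / 2"] by auto
      obtain m where m: "\<And>n. n \<ge> m \<Longrightarrow> \<bar>S n \<omega> - S m \<omega>\<bar> < 1 / real (Suc r)" using * by blast
      have "dist (S n \<omega>) (S n' \<omega>) < e" if "n \<ge> m" "n' \<ge> m" for n n'
        using m[OF that(1)] m[OF that(2)] r unfolding dist_real_def by linarith
      then show "\<exists>N. \<forall>n\<ge>N. \<forall>n'\<ge>N. dist (S n \<omega>) (S n' \<omega>) < e" by blast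
    qed
    then show "summable (\<lambda>n. d n \<omega>)"
      unfolding summable_iff_convergent S_def by (rule Cauchy_convergent)
  qed
qed

end

subsection \<open>Moments of the complex Gaussian distribution\<close>

text \<open>Lebesgue measure is determined by its values on boxes. The identity lets integrals
  against \<open>cn_density\<close> be computed as iterated real integrals.\<close>

lemma lborel_complex_eq_distr:
  "distr (lborel \<Otimes>\<^sub>M lborel) borel (\<lambda>(x, y). Complex x y) = (lborel :: complex measure)"
proof (rule lborel_eqI[symmetric])
  fix l u :: complex
  assume le: "\<And>b. b \<in> Basis \<Longrightarrow> l \<bullet> b \<le> u \<bullet> b"
  have le': "Re l \<le> Re u" "Im l \<le> Im u"
    using le[of 1] le[of \<i>] by (auto simp: Basis_complex_def inner_complex_def)
  have meas: "(\<lambda>(x, y). Complex x y) \<in> (lborel \<Otimes>\<^sub>M lborel) \<rightarrow>\<^sub>M borel"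
    unfolding Complex_eq by measurable
  have "emeasure (distr (lborel \<Otimes>\<^sub>M lborel) borel (\<lambda>(x, y). Complex x y)) (box l u) =
      emeasure (lborel \<Otimes>\<^sub>M lborel) ({Re l<..<Re u} \<times> {Im l<..<Im u})"
    by (subst emeasure_distr[OF meas])
      (auto simp: box_def Basis_complex_def inner_complex_def space_pair_measure
        intro!: arg_cong2[where f = emeasure])
  also have "\<dots> = emeasure lborel {Re l<..<Re u} * emeasure lborel {Im l<..<Im u}"
    by (rule lborel.emeasure_pair_measure_Times) auto
  also have "\<dots> = ennreal ((Re u - Re l) * (Im u - Im l))"
    using le' by (simp add: ennreal_mult)
  also have "(Re u - Re l) * (Im u - Im l) = (\<Prod>b\<in>Basis. (u - l) \<bullet> b)"
    by (simp add: Basis_complex_def inner_complex_def)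
  finally show "emeasure (distr (lborel \<Otimes>\<^sub>M lborel) borel (\<lambda>(x, y). Complex x y)) (box l u) =
      (\<Prod>b\<in>Basis. (u - l) \<bullet> b)" .
qed simp

text \<open>The squared modulus splits in the exponent, so real and imaginary part each receive half
  of the variance v.\<close>

lemma cn_density_Complex:
  assumes "0 < v"
  shows "cn_density v (Complex x y) =
    ennreal (normal_density 0 (sqrt (v / 2)) x) * ennreal (normal_density 0 (sqrt (v / 2)) y)"
proof -
  have s: "sqrt (v / 2) ^ 2 = v / 2" using assms by simp
  have "exp (- (x\<^sup>2 + y\<^sup>2) / v) / (pi * v) =
      (1 / sqrt (pi * v) * exp (- x\<^sup>2 / v)) * (1 / sqrt (pi * v) * exp (- y\<^sup>2 / v))"
    using assms by (simp add: exp_add[symmetric] add_divide_distrib diff_divide_distrib)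
  also have "\<dots> = normal_density 0 (sqrt (v / 2)) x * normal_density 0 (sqrt (v / 2)) y"
    unfolding normal_density_def s by simp
  finally show ?thesis
    unfolding cn_density_def by (simp add: cmod_power2 ennreal_mult[symmetric])
qed

lemma nn_integral_cn:
  fixes f :: "complex \<Rightarrow> ennreal"
  assumes D: "distributed M lborel h (cn_density v)" and v: "0 < v"
    and f [measurable]: "f \<in> borel_measurable borel"
  shows "(\<integral>\<^sup>+\<omega>. f (h \<omega>) \<partial>M) =
    (\<integral>\<^sup>+x. \<integral>\<^sup>+y. ennreal (normal_density 0 (sqrt (v / 2)) x) *
      ennreal (normal_density 0 (sqrt (v / 2)) y) * f (Complex x y) \<partial>lborel \<partial>lborel)"
proof -
  have meas [measurable]: "(\<lambda>(x, y). Complex x y) \<in> (lborel \<Otimes>\<^sub>M lborel) \<rightarrow>\<^sub>M borel"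
    unfolding Complex_eq by measurable
  have [measurable]: "cn_density v \<in> borel_measurable borel"
    unfolding cn_density_def by measurable
  have "(\<integral>\<^sup>+\<omega>. f (h \<omega>) \<partial>M) = (\<integral>\<^sup>+z. cn_density v z * f z \<partial>lborel)"
    by (rule distributed_nn_integral[OF D, symmetric]) simp
  also have "\<dots> = (\<integral>\<^sup>+p. cn_density v (Complex (fst p) (snd p)) * f (Complex (fst p) (snd p))
      \<partial>(lborel \<Otimes>\<^sub>M lborel))"
    by (subst lborel_complex_eq_distr[symmetric], subst nn_integral_distr[OF meas])
      (auto simp: case_prod_beta)
  also have "\<dots> = (\<integral>\<^sup>+x. \<integral>\<^sup>+y. cn_density v (Complex x y) * f (Complex x y) \<partial>lborel \<partial>lborel)"
    by (subst lborel.nn_integral_fst[symmetric]) (auto simp: Complex_eq)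
  finally show ?thesis by (simp add: cn_density_Complex[OF v] mult.assoc)
qed

lemma nn_integral_normal_density:
  "0 < s \<Longrightarrow> (\<integral>\<^sup>+x. ennreal (normal_density m s x) \<partial>lborel) = 1"
  by (subst nn_integral_eq_integral) auto

text \<open>In the iterated integral of an indicator that depends on one coordinate only, the other
  normal density integrates to 1.\<close>

lemma cn_Re_Im_normal:
  assumes D: "distributed M lborel h (cn_density v)" and v: "0 < v"
  shows "distributed M lborel (\<lambda>\<omega>. Re (h \<omega>)) (normal_density 0 (sqrt (v / 2)))"
    and "distributed M lborel (\<lambda>\<omega>. Im (h \<omega>)) (normal_density 0 (sqrt (v / 2)))"
proof -
  let ?\<phi> = "normal_density 0 (sqrt (v / 2))"
  have s: "0 < sqrt (v / 2)" using v by simp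
  have [measurable]: "h \<in> borel_measurable M" using distributed_measurable[OF D] by simp
  have one: "(\<integral>\<^sup>+x. ennreal (?\<phi> x) \<partial>lborel) = 1" by (rule nn_integral_normal_density[OF s])
  have "distr M lborel (\<lambda>\<omega>. Re (h \<omega>)) = density lborel (\<lambda>x. ennreal (?\<phi> x))"
  proof (rule measure_eqI)
    fix A assume "A \<in> sets (distr M lborel (\<lambda>\<omega>. Re (h \<omega>)))"
    then have [measurable]: "A \<in> sets borel" by simp
    have "emeasure (distr M lborel (\<lambda>\<omega>. Re (h \<omega>))) A = (\<integral>\<^sup>+\<omega>. indicator A (Re (h \<omega>)) \<partial>M)"
      by (subst nn_integral_distr[symmetric, where f = "indicator A" and M' = lborel]) auto
    also have "\<dots> = (\<integral>\<^sup>+x. \<integral>\<^sup>+y. ennreal (?\<phi> x) * ennreal (?\<phi> y) * indicator A x \<partial>lborel \<partial>lborel)"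
      by (subst nn_integral_cn[OF D v]) auto
    also have "\<dots> = (\<integral>\<^sup>+x. \<integral>\<^sup>+y. ennreal (?\<phi> x) * indicator A x * ennreal (?\<phi> y) \<partial>lborel \<partial>lborel)"
      by (simp add: mult_ac)
    also have "\<dots> = (\<integral>\<^sup>+x. ennreal (?\<phi> x) * indicator A x \<partial>lborel)"
      by (simp add: nn_integral_cmult one)
    also have "\<dots> = emeasure (density lborel (\<lambda>x. ennreal (?\<phi> x))) A"
      by (subst emeasure_density) auto
    finally show "emeasure (distr M lborel (\<lambda>\<omega>. Re (h \<omega>))) A = \<dots>" .
  qed simp
  then show "distributed M lborel (\<lambda>\<omega>. Re (h \<omega>)) ?\<phi>" by (simp add: distributed_def)
  have "distr M lborel (\<lambda>\<omega>. Im (h \<omega>)) = density lborel (\<lambda>x. ennreal (?\<phi> x))"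
  proof (rule measure_eqI)
    fix A assume "A \<in> sets (distr M lborel (\<lambda>\<omega>. Im (h \<omega>)))"
    then have [measurable]: "A \<in> sets borel" by simp
    have "emeasure (distr M lborel (\<lambda>\<omega>. Im (h \<omega>))) A = (\<integral>\<^sup>+\<omega>. indicator A (Im (h \<omega>)) \<partial>M)"
      by (subst nn_integral_distr[symmetric, where f = "indicator A" and M' = lborel]) auto
    also have "\<dots> = (\<integral>\<^sup>+x. \<integral>\<^sup>+y. ennreal (?\<phi> x) * (ennreal (?\<phi> y) * indicator A y) \<partial>lborel \<partial>lborel)"
      by (subst nn_integral_cn[OF D v]) (auto simp: mult.assoc)
    also have "\<dots> = (\<integral>\<^sup>+y. ennreal (?\<phi> y) * indicator A y \<partial>lborel)"
      by (simp add: nn_integral_cmult nn_integral_multc one)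
    also have "\<dots> = emeasure (density lborel (\<lambda>x. ennreal (?\<phi> x))) A"
      by (subst emeasure_density) auto
    finally show "emeasure (distr M lborel (\<lambda>\<omega>. Im (h \<omega>))) A = \<dots>" .
  qed simp
  then show "distributed M lborel (\<lambda>\<omega>. Im (h \<omega>)) ?\<phi>" by (simp add: distributed_def)
qed

lemma normal_moments:
  assumes D: "distributed M lborel X (\<lambda>x. ennreal (normal_density 0 s x))" and s: "0 < s"
  shows "integrable M (\<lambda>\<omega>. X \<omega> ^ n)"
    and "(\<integral>\<omega>. X \<omega> \<partial>M) = 0" and "(\<integral>\<omega>. X \<omega> ^ 2 \<partial>M) = s\<^sup>2" and "(\<integral>\<omega>. X \<omega> ^ 4 \<partial>M) = 3 * s ^ 4"
proof -
  show "integrable M (\<lambda>\<omega>. X \<omega> ^ n)"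
    using distributed_integrable[OF D, of "\<lambda>x. x ^ n"] integrable_normal_moment[OF s, of 0 n] by simp
  show "(\<integral>\<omega>. X \<omega> \<partial>M) = 0"
    using distributed_integral[OF D, of "\<lambda>x. x"] integral_normal_moment_nz_1[OF s, of 0] by simp
  show "(\<integral>\<omega>. X \<omega> ^ 2 \<partial>M) = s\<^sup>2"
    using distributed_integral[OF D, of "\<lambda>x. x ^ 2"] integral_normal_moment_even[OF s, of 0 1] by simp
  show "(\<integral>\<omega>. X \<omega> ^ 4 \<partial>M) = 3 * s ^ 4"
    using distributed_integral[OF D, of "\<lambda>x. x ^ 4"] integral_normal_moment_even[OF s, of 0 2] s
    by (simp add: fact_numeral power_divide divide_simps eval_nat_numeral)
qed

text \<open>The fourth moment is only bounded: from \<open>cmod4\<close> and the marginal value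
  \<open>3 * v\<^sup>2 / 4\<close> of each part one gets \<open>3 * v\<^sup>2\<close>, without the
  joint law of the two parts.\<close>

lemma (in prob_space) cn_moments:
  assumes D: "distributed M lborel h (cn_density v)" and v: "0 < v"
  shows "integrable M h" and "expectation h = 0"
    and "integrable M (\<lambda>\<omega>. (cmod (h \<omega>))\<^sup>2)" and "expectation (\<lambda>\<omega>. (cmod (h \<omega>))\<^sup>2) = v"
    and "integrable M (\<lambda>\<omega>. cmod (h \<omega>) ^ 4)" and "expectation (\<lambda>\<omega>. cmod (h \<omega>) ^ 4) \<le> 3 * v\<^sup>2"
proof -
  have s: "0 < sqrt (v / 2)" using v by simp
  have s2: "(sqrt (v / 2))\<^sup>2 = v / 2" using v by simp
  have s4: "sqrt (v / 2) ^ 4 = v\<^sup>2 / 4"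
    using arg_cong[OF s2, of "\<lambda>x. x\<^sup>2"] by (simp add: power_divide flip: power_mult)
  note Re = normal_moments[OF cn_Re_Im_normal(1)[OF D v] s]
  note Im = normal_moments[OF cn_Re_Im_normal(2)[OF D v] s]
  have [measurable]: "h \<in> borel_measurable M" using distributed_measurable[OF D] by simp
  have h: "h \<omega> = complex_of_real (Re (h \<omega>)) + \<i> * complex_of_real (Im (h \<omega>))" for \<omega>
    by (rule complex_eq)
  have i1: "integrable M (\<lambda>\<omega>. Re (h \<omega>))" "integrable M (\<lambda>\<omega>. Im (h \<omega>))"
    using Re(1)[of 1] Im(1)[of 1] by simp_all
  show int: "integrable M h"
  proof -
    have "integrable M (\<lambda>\<omega>. complex_of_real (Re (h \<omega>)) + \<i> * complex_of_real (Im (h \<omega>)))"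
      by (intro Bochner_Integration.integrable_add integrable_mult_right integrable_of_real i1)
    then show ?thesis by (simp only: h[symmetric])
  qed
  show "expectation h = 0"
    using Re(2) Im(2) int by (intro complex_eqI) simp_all
  show "integrable M (\<lambda>\<omega>. (cmod (h \<omega>))\<^sup>2)" "expectation (\<lambda>\<omega>. (cmod (h \<omega>))\<^sup>2) = v"
    using Re(1)[of 2] Im(1)[of 2] by (simp_all add: cmod_power2 Re(3) Im(3) s2)
  have cmod4: "cmod (h \<omega>) ^ 4 \<le> 2 * (Re (h \<omega>) ^ 4 + Im (h \<omega>) ^ 4)" for \<omega>
  proof -
    have "cmod (h \<omega>) ^ 4 = ((Re (h \<omega>))\<^sup>2 + (Im (h \<omega>))\<^sup>2)\<^sup>2"
      unfolding cmod_power2[symmetric] by (simp flip: power_mult)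
    also have "\<dots> \<le> 2 * (((Re (h \<omega>))\<^sup>2)\<^sup>2 + ((Im (h \<omega>))\<^sup>2)\<^sup>2)"
      using sum_squares_bound[of "(Re (h \<omega>))\<^sup>2" "(Im (h \<omega>))\<^sup>2"] by (simp add: power2_sum)
    finally show ?thesis by (simp flip: power_mult)
  qed
  have i4: "integrable M (\<lambda>\<omega>. 2 * (Re (h \<omega>) ^ 4 + Im (h \<omega>) ^ 4))" using Re(1)[of 4] Im(1)[of 4] by simp
  show i: "integrable M (\<lambda>\<omega>. cmod (h \<omega>) ^ 4)"
    by (rule Bochner_Integration.integrable_bound[OF i4]) (use cmod4 in \<open>auto intro!: AE_I2 order_trans[OF _ abs_ge_self]\<close>)
  have "expectation (\<lambda>\<omega>. cmod (h \<omega>) ^ 4) \<le> expectation (\<lambda>\<omega>. 2 * (Re (h \<omega>) ^ 4 + Im (h \<omega>) ^ 4))"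
    by (rule integral_mono[OF i i4 cmod4])
  also have "\<dots> = 3 * v\<^sup>2"
    using Re(1)[of 4] Im(1)[of 4] by (simp add: Re(4) Im(4) s4)
  finally show "expectation (\<lambda>\<omega>. cmod (h \<omega>) ^ 4) \<le> 3 * v\<^sup>2" .
qed

subsection \<open>Sigma-algebras generated by disjoint subfamilies\<close>

text \<open>Given by the preimage generators that occur in \<open>indep_vars\<close>, so that
  independence of the family passes directly to the sigma-algebras of disjoint index sets.\<close>

definition gen_algebra :: "'a measure \<Rightarrow> ('i \<Rightarrow> 'a \<Rightarrow> 'b::topological_space) \<Rightarrow> 'i set \<Rightarrow> 'a measure" where
  "gen_algebra M X A = sigma (space M) (\<Union>i\<in>A. {X i -` B \<inter> space M | B. B \<in> sets borel})"

lemma space_gen_algebra [simp]: "space (gen_algebra M X A) = space M"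
  by (simp add: gen_algebra_def space_measure_of_conv)

lemma sets_gen_algebra:
  "sets (gen_algebra M X A) = sigma_sets (space M) (\<Union>i\<in>A. {X i -` B \<inter> space M | B. B \<in> sets borel})"
  unfolding gen_algebra_def by (rule sets_measure_of) auto

lemma measurable_gen_algebra: "i \<in> A \<Longrightarrow> X i \<in> borel_measurable (gen_algebra M X A)"
  by (rule measurableI) (auto simp: sets_gen_algebra)

lemma sets_gen_algebra_mono: "A \<subseteq> B \<Longrightarrow> sets (gen_algebra M X A) \<subseteq> sets (gen_algebra M X B)"
  unfolding sets_gen_algebra by (rule sigma_sets_mono') auto

lemma subalgebra_gen_algebra:
  assumes "\<And>i. i \<in> A \<Longrightarrow> X i \<in> borel_measurable M"
  shows "subalgebra M (gen_algebra M X A)"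
proof -
  have "sets (gen_algebra M X A) \<subseteq> sets M"
    unfolding sets_gen_algebra using assms
    by (intro sets.sigma_sets_subset) (auto simp: measurable_sets)
  then show ?thesis by (simp add: subalgebra_def)
qed

text \<open>Grouping an independent family into disjoint blocks preserves independence, since the
  generators of each variable are closed under intersection. It serves to separate past from
  present, one link from the rest of the present, and two activation variables from each
  other.\<close>

lemma (in prob_space) indep_var_gen_algebra:
  assumes ind: "indep_vars (\<lambda>_. borel) X I" and AB: "A \<subseteq> I" "B \<subseteq> I" "A \<inter> B = {}"
    and G: "G \<in> borel_measurable (gen_algebra M X A)" and H: "H \<in> borel_measurable (gen_algebra M X B)"
  shows "indep_var borel G borel H"
proof -
  let ?E = "\<lambda>i. {X i -` B \<inter> space M | B. B \<in> sets borel}"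
  have rv: "X i \<in> borel_measurable M" if "i \<in> I" for i
    using ind that by (auto simp: indep_vars_def)
  have sub: "subalgebra M (gen_algebra M X A)" "subalgebra M (gen_algebra M X B)"
    using rv AB by (auto intro!: subalgebra_gen_algebra)
  have E: "indep_sets ?E (\<Union>b\<in>UNIV. case_bool A B b)"
  proof (rule indep_sets_mono_index)
    show "(\<Union>b\<in>UNIV. case_bool A B b) \<subseteq> I" using AB by (auto split: bool.splits)
    show "indep_sets ?E I" using ind unfolding indep_vars_def2 by blast
  qed
  have "indep_sets (\<lambda>b. sigma_sets (space M) (\<Union>i\<in>case_bool A B b. ?E i)) UNIV"
  proof (rule indep_sets_collect_sigma[OF E])
    fix b i
    show "Int_stable (?E i)"
    proof (rule Int_stableI)
      fix a b assume "a \<in> ?E i" "b \<in> ?E i"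
      then obtain A B where "a = X i -` A \<inter> space M" "b = X i -` B \<inter> space M" "A \<in> sets borel" "B \<in> sets borel"
        by auto
      then show "a \<inter> b \<in> ?E i" by (intro CollectI exI[of _ "A \<inter> B"]) auto
    qed
  next
    show "disjoint_family_on (case_bool A B) UNIV"
      using AB(3) by (auto simp: disjoint_family_on_def split: bool.splits)
  qed
  then have "indep_sets (case_bool (sets (gen_algebra M X A)) (sets (gen_algebra M X B))) UNIV"
    by (rule indep_sets_mono_sets) (auto simp: sets_gen_algebra split: bool.splits)
  then have "indep_set (sigma_sets (space M) {G -` A \<inter> space M | A. A \<in> sets borel})
      (sigma_sets (space M) {H -` A \<inter> space M | A. A \<in> sets borel})"
    unfolding indep_set_def
  proof (rule indep_sets_mono_sets)
    have "{G -` B \<inter> space M | B. B \<in> sets borel} \<subseteq> sets (gen_algebra M X A)"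
      using measurable_sets[OF G] by auto
    then have 1: "sigma_sets (space M) {G -` B \<inter> space M | B. B \<in> sets borel} \<subseteq> sets (gen_algebra M X A)"
      by (intro sets.sigma_sets_subset[where M = "gen_algebra M X A", simplified])
    have "{H -` A \<inter> space M | A. A \<in> sets borel} \<subseteq> sets (gen_algebra M X B)"
      using measurable_sets[OF H] by auto
    then have 2: "sigma_sets (space M) {H -` A \<inter> space M | A. A \<in> sets borel} \<subseteq> sets (gen_algebra M X B)"
      by (intro sets.sigma_sets_subset[where M = "gen_algebra M X B", simplified])
    fix b
    show "case_bool (sigma_sets (space M) {G -` A \<inter> space M | A. A \<in> sets borel})
        (sigma_sets (space M) {H -` A \<inter> space M | A. A \<in> sets borel}) b
      \<subseteq> case_bool (sets (gen_algebra M X A)) (sets (gen_algebra M X B)) b"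
      using 1 2 by (cases b) auto
  qed
  then show ?thesis
    using measurable_from_subalg[OF sub(1) G] measurable_from_subalg[OF sub(2) H]
    by (simp add: indep_var_eq)
qed

subsection \<open>The consensus protocol\<close>

text \<open>Bounding the square of the sum by \<open>card P\<close> times the sum of squares leaves
  only products within one index, where the factors are independent; nothing is needed about the
  relation between different indices.\<close>

lemma (in prob_space) indep_products_square:
  fixes f Z :: "'i \<Rightarrow> 'a \<Rightarrow> real"
  assumes P: "finite P"
    and ind: "\<And>a. a \<in> P \<Longrightarrow> indep_var borel (f a) borel (Z a)"
    and f: "\<And>a. a \<in> P \<Longrightarrow> integrable M (\<lambda>\<omega>. (f a \<omega>)\<^sup>2)"
    and Z: "\<And>a. a \<in> P \<Longrightarrow> integrable M (\<lambda>\<omega>. (Z a \<omega>)\<^sup>2)"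
  shows "integrable M (\<lambda>\<omega>. (\<Sum>a\<in>P. f a \<omega> * Z a \<omega>)\<^sup>2)"
    and "expectation (\<lambda>\<omega>. (\<Sum>a\<in>P. f a \<omega> * Z a \<omega>)\<^sup>2) \<le>
      real (card P) * (\<Sum>a\<in>P. expectation (\<lambda>\<omega>. (f a \<omega>)\<^sup>2) * expectation (\<lambda>\<omega>. (Z a \<omega>)\<^sup>2))"
proof -
  have [measurable]: "f a \<in> borel_measurable M" "Z a \<in> borel_measurable M" if "a \<in> P" for a
    using indep_var_rv1[OF ind[OF that]] indep_var_rv2[OF ind[OF that]] by auto
  have ind2: "indep_var borel (\<lambda>\<omega>. (f a \<omega>)\<^sup>2) borel (\<lambda>\<omega>. (Z a \<omega>)\<^sup>2)" if "a \<in> P" for a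
    using indep_var_compose[OF ind[OF that], of "\<lambda>t. t\<^sup>2" borel "\<lambda>t. t\<^sup>2" borel] by (simp add: comp_def)
  have int: "integrable M (\<lambda>\<omega>. (f a \<omega> * Z a \<omega>)\<^sup>2)"
    and E: "expectation (\<lambda>\<omega>. (f a \<omega> * Z a \<omega>)\<^sup>2) =
      expectation (\<lambda>\<omega>. (f a \<omega>)\<^sup>2) * expectation (\<lambda>\<omega>. (Z a \<omega>)\<^sup>2)" if "a \<in> P" for a
    using indep_var_integrable[OF ind2 f Z] indep_var_lebesgue_integral[OF ind2 f Z] that
    by (simp_all add: power_mult_distrib)
  show sq: "integrable M (\<lambda>\<omega>. (\<Sum>a\<in>P. f a \<omega> * Z a \<omega>)\<^sup>2)"
    using int by (intro integrable_square_sum P) auto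
  have "expectation (\<lambda>\<omega>. (\<Sum>a\<in>P. f a \<omega> * Z a \<omega>)\<^sup>2) \<le>
      expectation (\<lambda>\<omega>. (\<Sum>a\<in>P. (f a \<omega> * Z a \<omega>)\<^sup>2) * real (card P))"
    using int by (intro integral_mono sq sum_squared_le_sum_of_squares) auto
  also have "\<dots> = real (card P) * (\<Sum>a\<in>P. expectation (\<lambda>\<omega>. (f a \<omega> * Z a \<omega>)\<^sup>2))"
    using int by (simp add: Bochner_Integration.integral_sum mult.commute)
  also have "\<dots> = real (card P) * (\<Sum>a\<in>P. expectation (\<lambda>\<omega>. (f a \<omega>)\<^sup>2) * expectation (\<lambda>\<omega>. (Z a \<omega>)\<^sup>2))"
    using E by simp
  finally show "expectation (\<lambda>\<omega>. (\<Sum>a\<in>P. f a \<omega> * Z a \<omega>)\<^sup>2) \<le>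
      real (card P) * (\<Sum>a\<in>P. expectation (\<lambda>\<omega>. (f a \<omega>)\<^sup>2) * expectation (\<lambda>\<omega>. (Z a \<omega>)\<^sup>2))" .
qed

lemma cmod_sum_power2:
  "(cmod (\<Sum>j\<in>J. a j))\<^sup>2 = (\<Sum>j\<in>J. \<Sum>l\<in>J. Re (a j * cnj (a l)))"
proof -
  have "(cmod (\<Sum>j\<in>J. a j))\<^sup>2 = Re ((\<Sum>j\<in>J. a j) * cnj (\<Sum>j\<in>J. a j))"
    by (simp only: complex_norm_square[symmetric] Re_complex_of_real)
  then show ?thesis by (simp add: sum_product)
qed

primrec idx_time :: "rv_idx \<Rightarrow> nat" where
  "idx_time (Gam i k) = k"
| "idx_time (Chan i j k) = k"
| "idx_time (Noise i k) = k"

text \<open>The hypotheses behind the moment estimates. Connectivity and the remaining step size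
  conditions enter only in \<open>almost_sure_consensus\<close>.\<close>

locale ota_consensus = prob_space M for M :: "'a measure" +
  fixes N :: nat
    and E :: "nat \<Rightarrow> nat \<Rightarrow> nat \<Rightarrow> bool"
    and fail :: "nat \<Rightarrow> nat \<Rightarrow> bool"
    and \<rho> :: real and u :: complex
    and p :: "nat \<Rightarrow> real" and \<Lambda> :: "nat \<Rightarrow> nat \<Rightarrow> real" and \<sigma> :: "nat \<Rightarrow> real"
    and \<alpha> :: "nat \<Rightarrow> real" and x0 :: "nat \<Rightarrow> real"
    and X :: "rv_idx \<Rightarrow> 'a \<Rightarrow> complex"
  assumes N: "N \<ge> 1"
    and E_sym: "\<And>k i j. E k i j \<longleftrightarrow> E k j i"
    and E_irrefl: "\<And>k i. \<not> E k i i"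
    and fail_noedge: "\<And>k i j. fail k i \<Longrightarrow> \<not> E k i j"
    and rho: "\<rho> > 0"
    and u: "cmod u = 1"
    and p: "\<And>i. i < N \<Longrightarrow> 0 < p i \<and> p i < 1"
    and Lam: "\<And>i j. i < N \<Longrightarrow> j < N \<Longrightarrow> \<Lambda> i j = \<Lambda> j i \<and> \<Lambda> i j > 0"
    and sigma: "\<And>i. i < N \<Longrightarrow> \<sigma> i > 0"
    and indep: "indep_vars (\<lambda>_. borel) X (used_idx N)"
    and gam01: "\<And>i k \<omega>. i < N \<Longrightarrow> \<omega> \<in> space M \<Longrightarrow> X (Gam i k) \<omega> \<in> {0, 1}"
    and gam_p: "\<And>i k. i < N \<Longrightarrow> prob {\<omega> \<in> space M. X (Gam i k) \<omega> = 1} = p i"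
    and chan: "\<And>i j k. i < N \<Longrightarrow> j < N \<Longrightarrow> i \<noteq> j \<Longrightarrow>
                 distributed M lborel (X (Chan i j k)) (cn_density (\<Lambda> i j))"
    and noise: "\<And>i k. i < N \<Longrightarrow>
                 distributed M lborel (X (Noise i k)) (cn_density ((\<sigma> i)\<^sup>2))"
    and alpha_pos: "\<And>k. \<alpha> k > 0"
    and alpha_sq: "summable (\<lambda>k. (\<alpha> k)\<^sup>2)"
    and alpha_abar: "\<And>i k. i < N \<Longrightarrow> 1 - \<alpha> k * (\<Sum>j<N. abar E \<rho> p \<Lambda> k i j) > 0"
begin

definition x :: "nat \<Rightarrow> nat \<Rightarrow> 'a \<Rightarrow> real" where
  "x = state N E fail \<rho> u p \<Lambda> \<sigma> \<alpha> x0 X"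

abbreviation A :: "nat \<Rightarrow> nat \<Rightarrow> nat \<Rightarrow> real" where
  "A \<equiv> abar E \<rho> p \<Lambda>"

text \<open>The inequality is strict: \<open>x k\<close> is a function of the variables of times
  before k, whereas the update from k to \<open>k + 1\<close> uses those of time k. Disjointness of
  \<open>past k\<close> and \<open>now k\<close> is the source of all martingale
  orthogonality.\<close>

definition past :: "nat \<Rightarrow> rv_idx set" where
  "past k = {a \<in> used_idx N. idx_time a < k}"

definition now :: "nat \<Rightarrow> rv_idx set" where
  "now k = {a \<in> used_idx N. idx_time a = k}"

abbreviation F :: "nat \<Rightarrow> 'a measure" where
  "F k \<equiv> gen_algebra M X (past k)"

lemma X_measurable: "a \<in> used_idx N \<Longrightarrow> X a \<in> borel_measurable M"
  using indep by (auto simp: indep_vars_def)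

lemma subalgebra_gen: "B \<subseteq> used_idx N \<Longrightarrow> subalgebra M (gen_algebra M X B)"
  using X_measurable by (intro subalgebra_gen_algebra) auto

lemma gen_measurable_M:
  "B \<subseteq> used_idx N \<Longrightarrow> f \<in> borel_measurable (gen_algebra M X B) \<Longrightarrow> f \<in> borel_measurable M"
  by (rule measurable_from_subalg[OF subalgebra_gen])

lemma past_used: "past k \<subseteq> used_idx N" and now_used: "now k \<subseteq> used_idx N"
  by (auto simp: past_def now_def)

lemma past_now: "past k \<inter> now k = {}" and past_Suc: "past (Suc k) = past k \<union> now k"
  by (auto simp: past_def now_def)

lemma F_measurable_Suc: "f \<in> borel_measurable (F k) \<Longrightarrow> f \<in> borel_measurable (F (Suc k))"
  using sets_gen_algebra_mono[of "past k" "past (Suc k)" M X]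
  by (auto simp: past_Suc measurable_def)

lemma now_measurable_F_Suc:
  "f \<in> borel_measurable (gen_algebra M X (now k)) \<Longrightarrow> f \<in> borel_measurable (F (Suc k))"
  using sets_gen_algebra_mono[of "now k" "past (Suc k)" M X]
  by (auto simp: past_Suc measurable_def)

lemma used_idx_simps [simp]:
  "Gam i k \<in> used_idx N \<longleftrightarrow> i < N" "Noise i k \<in> used_idx N \<longleftrightarrow> i < N"
  "Chan i j k \<in> used_idx N \<longleftrightarrow> i < N \<and> j < N \<and> i \<noteq> j"
  by (auto simp: used_idx_def)

lemma A_nonneg: "i < N \<Longrightarrow> j < N \<Longrightarrow> 0 \<le> A k i j"
  using p[of i] p[of j] Lam[of i j] rho by (auto simp: abar_def intro!: mult_nonneg_nonneg add_nonneg_nonneg)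

lemma A_sym: "i < N \<Longrightarrow> j < N \<Longrightarrow> A k i j = A k j i"
  using E_sym[of k i j] Lam[of i j] by (simp add: abar_def add.commute)

section \<open>Separating past amplitudes from present coefficients in the received power\<close>

definition link :: "nat \<Rightarrow> nat \<Rightarrow> nat \<Rightarrow> rv_idx" where
  "link i j k = (if j = N then Noise i k else Chan i j k)"

definition var :: "nat \<Rightarrow> nat \<Rightarrow> real" where
  "var i j = (if j = N then (\<sigma> i)\<^sup>2 else \<Lambda> i j)"

text \<open>The receiver noise is treated as a channel from a fictitious sender \<open>N\<close> of amplitude 1;
  the factor \<open>cnj u\<close> compensates the common factor \<open>u\<close> of the genuine channels.\<close>

definition fading :: "nat \<Rightarrow> nat \<Rightarrow> nat \<Rightarrow> 'a \<Rightarrow> complex" where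
  "fading k i j \<omega> = (if j = N then cnj u * X (link i j k) \<omega> else X (link i j k) \<omega>)"

definition gate :: "nat \<Rightarrow> nat \<Rightarrow> nat \<Rightarrow> 'a \<Rightarrow> real" where
  "gate k i j \<omega> = (if j = N then 1 else Gamma X i j k \<omega>)"

definition coeff :: "nat \<Rightarrow> nat \<Rightarrow> nat \<Rightarrow> 'a \<Rightarrow> complex" where
  "coeff k i j \<omega> = complex_of_real (gate k i j \<omega>) * fading k i j \<omega>"

definition amp :: "nat \<Rightarrow> nat \<Rightarrow> 'a \<Rightarrow> real" where
  "amp k j \<omega> = (if j = N then 1 else sqrt (\<rho> * x k j \<omega>))"

text \<open>The mean of \<open>gate\<close>: for a genuine sender it is the probability that exactly
  one of the two agents is active. On an edge, \<open>\<rho> * gain i j * var i j\<close> is the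
  mean weight.\<close>

definition gain :: "nat \<Rightarrow> nat \<Rightarrow> real" where
  "gain i j = (if j = N then 1 else p i * (1 - p j) + p j * (1 - p i))"

definition senders :: "nat \<Rightarrow> nat \<Rightarrow> nat set" where
  "senders k i = insert N {j. j < N \<and> E k i j}"

text \<open>The centred product of two coefficients, indexed by a pair of senders. It is a function
  of the present alone; the states enter only through \<open>amp2\<close>, a function of the
  past.\<close>

definition Z :: "nat \<Rightarrow> nat \<Rightarrow> nat \<times> nat \<Rightarrow> 'a \<Rightarrow> real" where
  "Z k i = (\<lambda>(j, l) \<omega>. Re (coeff k i j \<omega> * cnj (coeff k i l \<omega>)) - (if j = l then gain i j * var i j else 0))"

definition amp2 :: "nat \<Rightarrow> nat \<times> nat \<Rightarrow> 'a \<Rightarrow> real" where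
  "amp2 k = (\<lambda>(j, l) \<omega>. amp k j \<omega> * amp k l \<omega>)"

definition \<xi> :: "nat \<Rightarrow> nat \<Rightarrow> 'a \<Rightarrow> real" where
  "\<xi> k i \<omega> = (if fail k i then 0 else \<Sum>a\<in>senders k i \<times> senders k i. amp2 k a \<omega> * Z k i a \<omega>)"

lemma finite_senders [simp]: "finite (senders k i)"
  by (simp add: senders_def)

lemma recv_eq:
  "recv N E \<rho> u X (x k) k i \<omega> = u * (\<Sum>j\<in>senders k i. coeff k i j \<omega> * complex_of_real (amp k j \<omega>))"
proof -
  have "u * cnj u = 1" using u complex_norm_square[of u] by simp
  then have "u * (cnj u * z) = z" for z by (simp flip: mult.assoc)
  then show ?thesis
    unfolding recv_def senders_def
    by (simp add: coeff_def gate_def fading_def amp_def link_def sum_distrib_left distrib_left mult_ac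
        cong: sum.cong_simp)
qed

lemma amp_square: "(amp k j \<omega>)\<^sup>2 = (if j = N then 1 else \<rho> * \<bar>x k j \<omega>\<bar>)"
  using rho by (simp add: amp_def power2_eq_square abs_mult)

text \<open>The squared modulus is a double sum over pairs of senders. Centring affects the diagonal
  only: the genuine senders produce the mean weights times \<open>\<bar>x\<bar>\<close>, the
  fictitious one produces the variance of the receiver noise.\<close>

lemma recv_square:
  assumes "i < N"
  shows "(cmod (recv N E \<rho> u X (x k) k i \<omega>))\<^sup>2 =
    (\<Sum>a\<in>senders k i \<times> senders k i. amp2 k a \<omega> * Z k i a \<omega>) + (\<Sum>j<N. A k i j * \<bar>x k j \<omega>\<bar>) + (\<sigma> i)\<^sup>2"
proof -
  let ?J = "senders k i"
  have "(cmod (recv N E \<rho> u X (x k) k i \<omega>))\<^sup>2 =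
      (\<Sum>j\<in>?J. \<Sum>l\<in>?J. amp k j \<omega> * amp k l \<omega> * Re (coeff k i j \<omega> * cnj (coeff k i l \<omega>)))"
    unfolding recv_eq norm_mult u
    by (simp only: mult_1 cmod_sum_power2) (simp add: algebra_simps)
  also have "\<dots> = (\<Sum>j\<in>?J. \<Sum>l\<in>?J. amp2 k (j, l) \<omega> * Z k i (j, l) \<omega>) +
      (\<Sum>j\<in>?J. \<Sum>l\<in>?J. if j = l then amp k j \<omega> * amp k l \<omega> * (gain i j * var i j) else 0)"
    unfolding sum.distrib[symmetric] amp2_def Z_def
    by (intro sum.cong refl) (auto simp: algebra_simps)
  also have "(\<Sum>j\<in>?J. \<Sum>l\<in>?J. if j = l then amp k j \<omega> * amp k l \<omega> * (gain i j * var i j) else 0) =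
      (\<Sum>j\<in>?J. (amp k j \<omega>)\<^sup>2 * (gain i j * var i j))"
    by (simp add: power2_eq_square)
  also have "\<dots> = (\<sigma> i)\<^sup>2 + (\<Sum>j | j < N \<and> E k i j. A k i j * \<bar>x k j \<omega>\<bar>)"
    unfolding senders_def amp_square
    by (simp add: gain_def var_def abar_def mult_ac cong: sum.cong_simp)
  also have "(\<Sum>j | j < N \<and> E k i j. A k i j * \<bar>x k j \<omega>\<bar>) = (\<Sum>j<N. A k i j * \<bar>x k j \<omega>\<bar>)"
    by (rule sum.mono_neutral_left) (auto simp: abar_def)
  finally show ?thesis by (simp add: sum.cartesian_product)
qed

text \<open>A failed agent has no edges, so its weights vanish, and \<xi> is zero for it by
  definition; both branches of the update thus take one form.\<close>

lemma x_rec: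
  assumes i: "i < N"
  shows "x (Suc k) i \<omega> = x k i \<omega> + \<alpha> k * (\<Sum>j<N. A k i j * (\<bar>x k j \<omega>\<bar> - x k i \<omega>)) + \<alpha> k * \<xi> k i \<omega>"
proof (cases "fail k i")
  case True
  then have "A k i j = 0" for j using fail_noedge by (simp add: abar_def)
  with True show ?thesis by (simp add: x_def \<xi>_def Let_def)
next
  case False
  then have "x (Suc k) i \<omega> = (1 - \<alpha> k * (\<Sum>j<N. A k i j)) * x k i \<omega>
      + \<alpha> k * ((cmod (recv N E \<rho> u X (x k) k i \<omega>))\<^sup>2 - (\<sigma> i)\<^sup>2)"
    by (simp add: x_def Let_def)
  moreover have eq: "(\<Sum>j<N. A k i j * (\<bar>x k j \<omega>\<bar> - x k i \<omega>)) =
      (\<Sum>j<N. A k i j * \<bar>x k j \<omega>\<bar>) - (\<Sum>j<N. A k i j) * x k i \<omega>"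
    by (simp add: right_diff_distrib sum_subtractf sum_distrib_right)
  ultimately show ?thesis
    using False unfolding recv_square[OF i] eq by (simp add: \<xi>_def algebra_simps)
qed

subsection \<open>Moments of the noise\<close>

lemma link_now: "i < N \<Longrightarrow> j \<in> senders k i \<Longrightarrow> link i j k \<in> now k"
  using E_irrefl by (auto simp: link_def now_def senders_def)

lemma link_inj: "link i j k = link i l k \<Longrightarrow> j = l"
  by (auto simp: link_def split: if_splits)

lemma fading_measurable:
  assumes "link i j k \<in> B"
  shows "fading k i j \<in> borel_measurable (gen_algebra M X B)"
proof -
  have [measurable]: "X (link i j k) \<in> borel_measurable (gen_algebra M X B)"
    using assms by (rule measurable_gen_algebra)
  show ?thesis unfolding fading_def[abs_def] by measurable
qed

text \<open>A gate reads only activation variables, so it remains measurable after any single link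
  is removed and is independent of the fading on that link.\<close>

lemma gate_measurable:
  assumes "i < N" "j \<in> senders k i"
  shows "gate k i j \<in> borel_measurable (gen_algebra M X (now k - {link i l k}))"
proof (cases "j = N")
  case False
  then have "j < N" using assms by (auto simp: senders_def)
  then have [measurable]: "X (Gam i k) \<in> borel_measurable (gen_algebra M X (now k - {link i l k}))"
    "X (Gam j k) \<in> borel_measurable (gen_algebra M X (now k - {link i l k}))"
    using assms by (auto intro!: measurable_gen_algebra simp: now_def link_def)
  show ?thesis using False unfolding gate_def[abs_def] Gamma_def gam_def by simp
qed (simp add: gate_def[abs_def])

lemma gate01:
  assumes "i < N" "j \<in> senders k i" "\<omega> \<in> space M"
  shows "gate k i j \<omega> = 0 \<or> gate k i j \<omega> = 1"
  using gam01[of i \<omega> k] gam01[of j \<omega> k] assms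
  by (auto simp: gate_def Gamma_def gam_def senders_def)

lemma now_measurable:
  assumes "i < N" "j \<in> senders k i"
  shows "fading k i j \<in> borel_measurable (gen_algebra M X (now k))"
    and "gate k i j \<in> borel_measurable (gen_algebra M X (now k))"
    and "coeff k i j \<in> borel_measurable (gen_algebra M X (now k))"
proof -
  show f [measurable]: "fading k i j \<in> borel_measurable (gen_algebra M X (now k))"
    using assms link_now by (intro fading_measurable)
  have "sets (gen_algebra M X (now k - {link i j k})) \<subseteq> sets (gen_algebra M X (now k))"
    by (intro sets_gen_algebra_mono) auto
  then show g [measurable]: "gate k i j \<in> borel_measurable (gen_algebra M X (now k))"
    using gate_measurable[OF assms, of j] by (auto simp: measurable_def)
  show "coeff k i j \<in> borel_measurable (gen_algebra M X (now k))"
    unfolding coeff_def[abs_def] by measurable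
qed

lemmas now_M = now_measurable[THEN gen_measurable_M[OF now_used]]

lemma fading_moments:
  assumes i: "i < N" and j: "j \<in> senders k i"
  shows "integrable M (fading k i j)" and "expectation (fading k i j) = 0"
    and "integrable M (\<lambda>\<omega>. (cmod (fading k i j \<omega>))\<^sup>2)"
    and "expectation (\<lambda>\<omega>. (cmod (fading k i j \<omega>))\<^sup>2) = var i j"
    and "integrable M (\<lambda>\<omega>. cmod (fading k i j \<omega>) ^ 4)"
    and "expectation (\<lambda>\<omega>. cmod (fading k i j \<omega>) ^ 4) \<le> 3 * (var i j)\<^sup>2"
    and "0 < var i j"
proof -
  have ij: "j < N \<Longrightarrow> i \<noteq> j" "j = N \<or> j < N" using j E_irrefl by (auto simp: senders_def)
  show v: "0 < var i j" using sigma[OF i] Lam[OF i] ij by (auto simp: var_def)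
  have D: "distributed M lborel (X (link i j k)) (cn_density (var i j))"
    using chan[OF i] noise[OF i] ij by (auto simp: link_def var_def)
  note m = cn_moments[OF D v]
  show "integrable M (fading k i j)" "expectation (fading k i j) = 0"
    using m(1,2) by (cases "j = N"; simp add: fading_def[abs_def])+
  have "cmod (fading k i j \<omega>) = cmod (X (link i j k) \<omega>)" for \<omega>
    by (simp add: fading_def norm_mult u)
  then show "integrable M (\<lambda>\<omega>. (cmod (fading k i j \<omega>))\<^sup>2)"
    "expectation (\<lambda>\<omega>. (cmod (fading k i j \<omega>))\<^sup>2) = var i j"
    "integrable M (\<lambda>\<omega>. cmod (fading k i j \<omega>) ^ 4)"
    "expectation (\<lambda>\<omega>. cmod (fading k i j \<omega>) ^ 4) \<le> 3 * (var i j)\<^sup>2"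
    using m(3-6) by simp_all
qed

lemma gam_moments:
  assumes i: "i < N"
  shows "integrable M (gam X i k)" and "expectation (gam X i k) = p i"
proof -
  have [measurable]: "X (Gam i k) \<in> borel_measurable M" using X_measurable i by simp
  have eq: "gam X i k \<omega> = indicator {\<omega> \<in> space M. X (Gam i k) \<omega> = 1} \<omega>" if "\<omega> \<in> space M" for \<omega>
    using gam01[OF i that, of k] that by (auto simp: gam_def)
  have S: "{\<omega> \<in> space M. X (Gam i k) \<omega> = 1} \<in> events" by measurable
  have "integrable M (indicator {\<omega> \<in> space M. X (Gam i k) \<omega> = 1} :: 'a \<Rightarrow> real)"
    using S by (intro integrable_real_indicator) (auto simp: less_top[symmetric])
  then show "integrable M (gam X i k)"
    by (subst Bochner_Integration.integrable_cong[OF refl eq]) auto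
  have "expectation (gam X i k) = expectation (indicator {\<omega> \<in> space M. X (Gam i k) \<omega> = 1})"
    by (rule Bochner_Integration.integral_cong[OF refl eq])
  also have "\<dots> = p i" using gam_p[OF i, of k] S by simp
  finally show "expectation (gam X i k) = p i" .
qed

lemma gate_mean:
  assumes i: "i < N" and j: "j \<in> senders k i"
  shows "integrable M (gate k i j)" and "expectation (gate k i j) = gain i j"
proof -
  have "integrable M (gate k i j) \<and> expectation (gate k i j) = gain i j"
  proof (cases "j = N")
    case True
    then show ?thesis by (simp add: gate_def[abs_def] gain_def prob_space)
  next
    case False
    then have jN: "j < N" and ij: "i \<noteq> j" using j E_irrefl by (auto simp: senders_def)
    note gi = gam_moments[OF i, of k] and gj = gam_moments[OF jN, of k]
    have "gam X a k \<in> borel_measurable (gen_algebra M X {Gam a k})" for a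
    proof -
      have [measurable]: "X (Gam a k) \<in> borel_measurable (gen_algebra M X {Gam a k})"
        by (rule measurable_gen_algebra) simp
      show ?thesis unfolding gam_def[abs_def] by measurable
    qed
    then have ind: "indep_var borel (gam X i k) borel (gam X j k)"
      by (intro indep_var_gen_algebra[OF indep, of "{Gam i k}" "{Gam j k}"]) (use i jN ij in auto)
    note ij' = indep_var_integrable[OF ind gi(1) gj(1)] indep_var_lebesgue_integral[OF ind gi(1) gj(1)]
    have eq: "gate k i j = (\<lambda>\<omega>. gam X i k \<omega> + gam X j k \<omega> - 2 * (gam X i k \<omega> * gam X j k \<omega>))"
      using False by (auto simp: gate_def Gamma_def algebra_simps)
    show ?thesis
      unfolding eq using gi gj ij' False by (simp add: gain_def algebra_simps)
  qed
  then show "integrable M (gate k i j)" "expectation (gate k i j) = gain i j" by auto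
qed

lemma cmod_coeff_le:
  assumes "i < N" "j \<in> senders k i" "\<omega> \<in> space M"
  shows "cmod (coeff k i j \<omega>) \<le> cmod (fading k i j \<omega>)"
  using gate01[OF assms] by (auto simp: coeff_def norm_mult)

text \<open>The 8 is 3 + 3 + 2: two fourth moments of fading, each at most three squared variances,
  and twice the square of the subtracted mean. Summing over all pairs replaces a maximum.\<close>

definition moment_bound :: real where
  "moment_bound = 8 * (\<Sum>i<N. \<Sum>j\<le>N. (var i j)\<^sup>2)"

lemma var_square_le:
  assumes "i < N" "j \<le> N"
  shows "8 * (var i j)\<^sup>2 \<le> moment_bound"
proof -
  have "(var i j)\<^sup>2 \<le> (\<Sum>j\<le>N. (var i j)\<^sup>2)"
    using assms by (intro member_le_sum[where f = "\<lambda>j. (var i j)\<^sup>2"]) auto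
  also have "\<dots> \<le> (\<Sum>i<N. \<Sum>j\<le>N. (var i j)\<^sup>2)"
    using assms by (intro member_le_sum[where f = "\<lambda>i. \<Sum>j\<le>N. (var i j)\<^sup>2"]) (auto intro: sum_nonneg)
  finally show ?thesis by (simp add: moment_bound_def)
qed

lemma gain_bounds: "i < N \<Longrightarrow> j \<in> senders k i \<Longrightarrow> 0 \<le> gain i j \<and> gain i j \<le> 1"
proof -
  assume i: "i < N" and "j \<in> senders k i"
  then have "j = N \<or> j < N" by (auto simp: senders_def)
  moreover have "0 \<le> a * (1 - b) + b * (1 - a) \<and> a * (1 - b) + b * (1 - a) \<le> 1"
    if "0 < a" "a < 1" "0 < b" "b < 1" for a b :: real
  proof
    show "0 \<le> a * (1 - b) + b * (1 - a)" using that by (intro add_nonneg_nonneg mult_nonneg_nonneg) auto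
    have "0 \<le> a * b + (1 - a) * (1 - b)" using that by (intro add_nonneg_nonneg mult_nonneg_nonneg) auto
    then show "a * (1 - b) + b * (1 - a) \<le> 1" by (simp add: algebra_simps)
  qed
  ultimately show ?thesis using p[OF i] p[of j] by (auto simp: gain_def)
qed

lemma Z_moments:
  assumes i: "i < N" and a: "a \<in> senders k i \<times> senders k i"
  shows "Z k i a \<in> borel_measurable (gen_algebra M X (now k))"
    and "integrable M (\<lambda>\<omega>. (Z k i a \<omega>)\<^sup>2)"
    and "expectation (\<lambda>\<omega>. (Z k i a \<omega>)\<^sup>2) \<le> moment_bound"
    and "expectation (Z k i a) = 0"
proof -
  obtain j l where a_eq: "a = (j, l)" and j: "j \<in> senders k i" and l: "l \<in> senders k i"
    using a by auto
  have jl: "j \<le> N" "l \<le> N" using j l by (auto simp: senders_def)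
  note cj [measurable] = now_measurable(3)[OF i j] and cl [measurable] = now_measurable(3)[OF i l]
  show meas: "Z k i a \<in> borel_measurable (gen_algebra M X (now k))"
    unfolding a_eq Z_def by simp
  note ZM [measurable] = gen_measurable_M[OF now_used meas]
  note [measurable] = now_M[OF i j] now_M[OF i l]
  note fj = fading_moments[OF i j] and fl = fading_moments[OF i l]
  let ?m = "if j = l then gain i j * var i j else 0"
  have m2: "?m\<^sup>2 \<le> (var i j)\<^sup>2"
    using gain_bounds[OF i j] fj(7) by (auto simp: power_mult_distrib intro!: mult_left_le_one_le power_le_one)
  have bound: "(Z k i a \<omega>)\<^sup>2 \<le> cmod (fading k i j \<omega>) ^ 4 + cmod (fading k i l \<omega>) ^ 4 + 2 * (var i j)\<^sup>2"
    if w: "\<omega> \<in> space M" for \<omega>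
  proof -
    let ?r = "Re (coeff k i j \<omega> * cnj (coeff k i l \<omega>))"
    let ?f = "cmod (fading k i j \<omega>)" and ?g = "cmod (fading k i l \<omega>)"
    have "(Z k i a \<omega>)\<^sup>2 \<le> 2 * ?r\<^sup>2 + 2 * ?m\<^sup>2"
      using sum_squares_bound[of ?r "- ?m"] unfolding a_eq Z_def by (simp add: power2_diff)
    moreover have "\<bar>?r\<bar> \<le> ?f * ?g"
      using abs_Re_le_cmod[of "coeff k i j \<omega> * cnj (coeff k i l \<omega>)"]
        mult_mono[OF cmod_coeff_le[OF i j w] cmod_coeff_le[OF i l w]]
      by (simp add: norm_mult)
    then have "?r\<^sup>2 \<le> (?f * ?g)\<^sup>2" using power_mono[of "\<bar>?r\<bar>" "?f * ?g" 2] by simp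
    moreover have "2 * (?f * ?g)\<^sup>2 \<le> ?f ^ 4 + ?g ^ 4"
      using sum_squares_bound[of "?f\<^sup>2" "?g\<^sup>2"] by (simp add: power_mult_distrib flip: power_mult)
    ultimately show ?thesis using m2 by linarith
  qed
  let ?B = "\<lambda>\<omega>. cmod (fading k i j \<omega>) ^ 4 + cmod (fading k i l \<omega>) ^ 4 + 2 * (var i j)\<^sup>2"
  have intB: "integrable M ?B" using fj(5) fl(5) by simp
  show intZ2: "integrable M (\<lambda>\<omega>. (Z k i a \<omega>)\<^sup>2)"
  proof (rule Bochner_Integration.integrable_bound[OF intB])
    show "AE \<omega> in M. norm ((Z k i a \<omega>)\<^sup>2) \<le> norm (?B \<omega>)"
    proof (rule AE_I2)
      fix \<omega> assume "\<omega> \<in> space M"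
      from order_trans[OF bound[OF this] abs_ge_self]
      show "norm ((Z k i a \<omega>)\<^sup>2) \<le> norm (?B \<omega>)" by simp
    qed
  qed measurable
  have "expectation (\<lambda>\<omega>. (Z k i a \<omega>)\<^sup>2) \<le> expectation ?B"
    by (rule integral_mono[OF intZ2 intB bound])
  also have "\<dots> \<le> 3 * (var i j)\<^sup>2 + 3 * (var i l)\<^sup>2 + 2 * (var i j)\<^sup>2"
    using fj(5,6) fl(5,6) by (simp add: prob_space)
  also have "\<dots> \<le> moment_bound"
    using var_square_le[OF i jl(1)] var_square_le[OF i jl(2)] by simp
  finally show "expectation (\<lambda>\<omega>. (Z k i a \<omega>)\<^sup>2) \<le> moment_bound" .
  \<comment> \<open>The fading on the link from l is isolated from everything else at time k; both
    cases below factor the expectation along this split.\<close>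
  have ind: "indep_var borel P borel Q"
    if "P \<in> borel_measurable (gen_algebra M X (now k - {link i l k}))"
      "Q \<in> borel_measurable (gen_algebra M X {link i l k})" for P Q :: "'a \<Rightarrow> 'c::topological_space"
    using that link_now[OF i l] now_used
    by (intro indep_var_gen_algebra[OF indep, of "now k - {link i l k}" "{link i l k}"]) auto
  have fl_meas [measurable]: "fading k i l \<in> borel_measurable (gen_algebra M X {link i l k})"
    by (rule fading_measurable) simp
  note gates [measurable] = gate_measurable[OF i j, of l] gate_measurable[OF i l, of l]
  show "expectation (Z k i a) = 0"
  proof (cases "j = l")
    case True
    have ind': "indep_var borel (gate k i l) borel (\<lambda>\<omega>. (cmod (fading k i l \<omega>))\<^sup>2)"
      by (intro ind) measurable
    note prod = indep_var_integrable[OF ind' gate_mean(1)[OF i l] fl(3)]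
      indep_var_lebesgue_integral[OF ind' gate_mean(1)[OF i l] fl(3)]
    \<comment> \<open>On the diagonal the gate occurs squared and, having values 0 and 1, equals its
      own square, so that its mean \<open>gain\<close> suffices.\<close>
    have Z_eq: "Z k i a \<omega> = gate k i l \<omega> * (cmod (fading k i l \<omega>))\<^sup>2 - gain i l * var i l"
      if "\<omega> \<in> space M" for \<omega>
      using gate01[OF i l that] True unfolding a_eq Z_def cmod_power2
      by (auto simp: coeff_def power2_eq_square)
    have "expectation (Z k i a) =
        expectation (\<lambda>\<omega>. gate k i l \<omega> * (cmod (fading k i l \<omega>))\<^sup>2 - gain i l * var i l)"
      by (rule Bochner_Integration.integral_cong[OF refl Z_eq])
    then show ?thesis
      using prod gate_mean(2)[OF i l] fl(4) by (simp add: prob_space)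
  next
    case False
    have "link i j k \<in> now k - {link i l k}" using link_now[OF i j] link_inj False by auto
    then have fj_meas [measurable]:
        "fading k i j \<in> borel_measurable (gen_algebra M X (now k - {link i l k}))"
      by (rule fading_measurable)
    \<comment> \<open>Off the diagonal both gates and the other fading factor are gathered in
      \<open>?P\<close>; the isolated factor has mean zero and annihilates the product.\<close>
    let ?P = "\<lambda>\<omega>. complex_of_real (gate k i j \<omega> * gate k i l \<omega>) * fading k i j \<omega>"
    have P_meas: "?P \<in> borel_measurable (gen_algebra M X (now k - {link i l k}))"
      by (intro borel_measurable_times fj_meas
          measurable_compose[OF borel_measurable_times[OF gates] borel_measurable_of_real])
    have ind': "indep_var borel ?P borel (\<lambda>\<omega>. cnj (fading k i l \<omega>))"
      by (intro ind P_meas measurable_compose[OF fl_meas]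
          borel_measurable_continuous_onI[OF continuous_on_cnj[OF continuous_on_id]])
    have intP: "integrable M ?P"
    proof (rule Bochner_Integration.integrable_bound[OF fj(1)])
      show "AE \<omega> in M. cmod (?P \<omega>) \<le> cmod (fading k i j \<omega>)"
      proof (rule AE_I2)
        fix \<omega> assume w: "\<omega> \<in> space M"
        show "cmod (?P \<omega>) \<le> cmod (fading k i j \<omega>)"
          using gate01[OF i j w] gate01[OF i l w] by (auto simp: norm_mult)
      qed
      show "?P \<in> borel_measurable M"
        using now_used by (intro gen_measurable_M[OF _ P_meas]) auto
    qed
    have intQ: "integrable M (\<lambda>\<omega>. cnj (fading k i l \<omega>))" using fl(1) by simp
    have "Z k i a = (\<lambda>\<omega>. Re (?P \<omega> * cnj (fading k i l \<omega>)))"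
      using False unfolding a_eq Z_def by (auto simp: coeff_def mult_ac)
    then have "expectation (Z k i a) = Re (expectation (\<lambda>\<omega>. ?P \<omega> * cnj (fading k i l \<omega>)))"
      by (simp only: integral_Re[OF indep_var_integrable[OF ind' intP intQ]])
    also have "expectation (\<lambda>\<omega>. ?P \<omega> * cnj (fading k i l \<omega>)) =
        expectation ?P * cnj (expectation (fading k i l))"
      by (subst indep_var_lebesgue_integral[OF ind' intP intQ]) simp
    finally show ?thesis by (simp add: fl(2))
  qed
qed

lemma amp2_measurable:
  assumes x: "\<And>j. j < N \<Longrightarrow> x k j \<in> borel_measurable G" and a: "a \<in> senders k i \<times> senders k i"
  shows "amp2 k a \<in> borel_measurable G"
proof -
  have amp: "amp k j \<in> borel_measurable G" if "j \<in> senders k i" for j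
  proof (cases "j = N")
    case False
    then have [measurable]: "x k j \<in> borel_measurable G" using that x by (auto simp: senders_def)
    show ?thesis using False by (simp add: amp_def[abs_def])
  qed (simp add: amp_def[abs_def])
  obtain j l where "a = (j, l)" "j \<in> senders k i" "l \<in> senders k i" using a by auto
  then show ?thesis using amp by (simp add: amp2_def)
qed

lemma xi_adapted:
  assumes i: "i < N" and x: "\<And>j. j < N \<Longrightarrow> x k j \<in> borel_measurable (F k)"
  shows "\<xi> k i \<in> borel_measurable (F (Suc k))"
proof (cases "fail k i")
  case False
  have "(\<lambda>\<omega>. \<Sum>a\<in>senders k i \<times> senders k i. amp2 k a \<omega> * Z k i a \<omega>) \<in> borel_measurable (F (Suc k))"
    by (intro borel_measurable_sum borel_measurable_times amp2_measurable
        now_measurable_F_Suc[OF Z_moments(1)[OF i]] F_measurable_Suc[OF x])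
  then show ?thesis using False by (simp add: \<xi>_def[abs_def])
qed (simp add: \<xi>_def[abs_def])

lemma x_adapted: "i < N \<Longrightarrow> x k i \<in> borel_measurable (F k)"
proof (induction k arbitrary: i)
  case 0
  then show ?case by (simp add: x_def)
next
  case (Suc k)
  have [measurable]: "x k j \<in> borel_measurable (F (Suc k))" if "j < N" for j
    using Suc.IH[OF that] by (rule F_measurable_Suc)
  have [measurable]: "\<xi> k i \<in> borel_measurable (F (Suc k))"
    using Suc by (intro xi_adapted)
  show ?case
    unfolding x_rec[OF Suc.prems, abs_def] ext[OF x_rec[OF Suc.prems]]
    using Suc.prems by (intro borel_measurable_add borel_measurable_times borel_measurable_const
        borel_measurable_sum borel_measurable_diff borel_measurable_abs) auto
qed

lemma x_measurable [measurable]: "i < N \<Longrightarrow> x k i \<in> borel_measurable M"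
  using x_adapted by (rule gen_measurable_M[OF past_used])

lemma xi_measurable [measurable]: "i < N \<Longrightarrow> \<xi> k i \<in> borel_measurable M"
  using xi_adapted[OF _ x_adapted] by (rule gen_measurable_M[OF past_used])

definition energy :: "nat \<Rightarrow> real" where
  "energy k = (\<Sum>j<N. expectation (\<lambda>\<omega>. (x k j \<omega>)\<^sup>2))"

lemma energy_sum:
  assumes sq: "\<And>j. j < N \<Longrightarrow> integrable M (\<lambda>\<omega>. (x k j \<omega>)\<^sup>2)"
  shows "integrable M (\<lambda>\<omega>. \<Sum>j<N. (x k j \<omega>)\<^sup>2)"
    and "expectation (\<lambda>\<omega>. \<Sum>j<N. (x k j \<omega>)\<^sup>2) = energy k"
  unfolding energy_def
  by (intro Bochner_Integration.integrable_sum Bochner_Integration.integral_sum sq; simp)+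

lemma amp2_adapted: "a \<in> senders k i \<times> senders k i \<Longrightarrow> amp2 k a \<in> borel_measurable (F k)"
  by (rule amp2_measurable[OF x_adapted])

text \<open>The fourth power of an amplitude is \<open>\<rho>\<^sup>2 * x\<^sup>2\<close>, or 1 for
  the fictitious sender. Hence second moments of the states suffice to control those of the noise,
  and the bound is affine in \<open>energy k\<close>.\<close>

lemma amp2_square:
  assumes sq: "\<And>j. j < N \<Longrightarrow> integrable M (\<lambda>\<omega>. (x k j \<omega>)\<^sup>2)" and a: "a \<in> senders k i \<times> senders k i"
  shows "integrable M (\<lambda>\<omega>. (amp2 k a \<omega>)\<^sup>2)"
    and "expectation (\<lambda>\<omega>. (amp2 k a \<omega>)\<^sup>2) \<le> 1 + \<rho>\<^sup>2 * energy k"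
proof -
  have [measurable]: "amp2 k a \<in> borel_measurable M"
    by (rule gen_measurable_M[OF past_used amp2_adapted[OF a]])
  let ?B = "\<lambda>\<omega>. 1 + \<rho>\<^sup>2 * (\<Sum>j<N. (x k j \<omega>)\<^sup>2)"
  have amp4: "(amp k j \<omega>) ^ 4 \<le> ?B \<omega>" if "j \<in> senders k i" for j \<omega>
  proof (cases "j = N")
    case True
    then show ?thesis by (simp add: amp_def sum_nonneg)
  next
    case False
    then have j: "j < N" using that by (auto simp: senders_def)
    have "(amp k j \<omega>) ^ 4 = ((amp k j \<omega>)\<^sup>2)\<^sup>2" by (simp flip: power_mult)
    also have "\<dots> = \<rho>\<^sup>2 * (x k j \<omega>)\<^sup>2" unfolding amp_square using False by (simp add: power_mult_distrib)
    also have "\<dots> \<le> \<rho>\<^sup>2 * (\<Sum>j<N. (x k j \<omega>)\<^sup>2)"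
      using j by (intro mult_left_mono member_le_sum[where f = "\<lambda>j. (x k j \<omega>)\<^sup>2"]) auto
    finally show ?thesis by simp
  qed
  have bound: "(amp2 k a \<omega>)\<^sup>2 \<le> ?B \<omega>" for \<omega>
  proof -
    obtain j l where jl: "a = (j, l)" "j \<in> senders k i" "l \<in> senders k i" using a by auto
    have "2 * (amp2 k a \<omega>)\<^sup>2 \<le> (amp k j \<omega>) ^ 4 + (amp k l \<omega>) ^ 4"
      using sum_squares_bound[of "(amp k j \<omega>)\<^sup>2" "(amp k l \<omega>)\<^sup>2"]
      by (simp add: jl(1) amp2_def power_mult_distrib flip: power_mult)
    then show ?thesis using amp4[OF jl(2), of \<omega>] amp4[OF jl(3), of \<omega>] by linarith
  qed
  have intB: "integrable M ?B"
    by (intro Bochner_Integration.integrable_add integrable_mult_right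
        Bochner_Integration.integrable_sum integrable_const sq) auto
  show int: "integrable M (\<lambda>\<omega>. (amp2 k a \<omega>)\<^sup>2)"
  proof (rule Bochner_Integration.integrable_bound[OF intB])
    show "AE \<omega> in M. norm ((amp2 k a \<omega>)\<^sup>2) \<le> norm (?B \<omega>)"
      using order_trans[OF bound abs_ge_self] by simp
  qed measurable
  have "expectation (\<lambda>\<omega>. (amp2 k a \<omega>)\<^sup>2) \<le> expectation ?B"
    by (rule integral_mono[OF int intB bound])
  also have "\<dots> = 1 + \<rho>\<^sup>2 * energy k"
    using energy_sum[OF sq] by (simp add: prob_space)
  finally show "expectation (\<lambda>\<omega>. (amp2 k a \<omega>)\<^sup>2) \<le> 1 + \<rho>\<^sup>2 * energy k" .
qed

lemma past_now_indep:
  assumes "f \<in> borel_measurable (F k)" "g \<in> borel_measurable (gen_algebra M X (now k))"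
  shows "indep_var borel f borel g"
  by (rule indep_var_gen_algebra[OF indep past_used now_used past_now assms])

lemma moment_bound_nonneg: "0 \<le> moment_bound"
  by (simp add: moment_bound_def sum_nonneg)

lemma energy_nonneg: "0 \<le> energy k"
  unfolding energy_def by (intro sum_nonneg Bochner_Integration.integral_nonneg) simp

text \<open>At most \<open>(N + 1)\<^sup>2\<close> pairs of senders occur, and their number enters
  twice: through the inequality for the square of a sum and through the count of summands. The
  factor \<open>1 + \<rho>\<^sup>2\<close> allows the bound to be written with
  \<open>1 + energy k\<close>.\<close>

definition noise_const :: real where
  "noise_const = real (Suc N) ^ 4 * (1 + \<rho>\<^sup>2) * moment_bound"

lemma noise_const_nonneg: "0 \<le> noise_const"
  by (simp add: noise_const_def moment_bound_nonneg)

lemma xi_square: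
  assumes i: "i < N" and sq: "\<And>j. j < N \<Longrightarrow> integrable M (\<lambda>\<omega>. (x k j \<omega>)\<^sup>2)"
  shows "integrable M (\<lambda>\<omega>. (\<xi> k i \<omega>)\<^sup>2)"
    and "expectation (\<lambda>\<omega>. (\<xi> k i \<omega>)\<^sup>2) \<le> noise_const * (1 + energy k)"
proof -
  let ?P = "senders k i \<times> senders k i"
  have ind: "indep_var borel (amp2 k a) borel (Z k i a)" if "a \<in> ?P" for a
    using that by (intro past_now_indep[where k = k] amp2_adapted Z_moments(1)[OF i])
  note sqs = indep_products_square[of ?P "amp2 k" "Z k i", OF _ ind amp2_square(1)[OF sq] Z_moments(2)[OF i]]
  have "integrable M (\<lambda>\<omega>. (\<Sum>a\<in>?P. amp2 k a \<omega> * Z k i a \<omega>)\<^sup>2)"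
    by (rule sqs(1)) auto
  then show "integrable M (\<lambda>\<omega>. (\<xi> k i \<omega>)\<^sup>2)" by (cases "fail k i") (simp_all add: \<xi>_def[abs_def])
  have "card (senders k i) \<le> card {..N}"
    by (intro card_mono) (auto simp: senders_def)
  then have c: "real (card ?P) \<le> (real (Suc N))\<^sup>2"
    unfolding card_cartesian_product power2_eq_square of_nat_mult by (intro mult_mono) auto
  let ?b = "(1 + \<rho>\<^sup>2 * energy k) * moment_bound"
  have b: "0 \<le> ?b" using energy_nonneg moment_bound_nonneg by simp
  have "expectation (\<lambda>\<omega>. (\<Sum>a\<in>?P. amp2 k a \<omega> * Z k i a \<omega>)\<^sup>2) \<le>
      real (card ?P) * (\<Sum>a\<in>?P. expectation (\<lambda>\<omega>. (amp2 k a \<omega>)\<^sup>2) * expectation (\<lambda>\<omega>. (Z k i a \<omega>)\<^sup>2))"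
    by (rule sqs(2)) auto
  also have "\<dots> \<le> real (card ?P) * (\<Sum>a\<in>?P. ?b)"
    using amp2_square[OF sq] Z_moments(3)[OF i] energy_nonneg[of k]
    by (intro mult_left_mono sum_mono mult_mono) auto
  also have "\<dots> = real (card ?P) * real (card ?P) * ?b" by simp
  also have "\<dots> \<le> (real (Suc N))\<^sup>2 * (real (Suc N))\<^sup>2 * ?b"
    using c b by (intro mult_right_mono mult_mono) auto
  also have "\<dots> \<le> (real (Suc N))\<^sup>2 * (real (Suc N))\<^sup>2 * ((1 + \<rho>\<^sup>2) * (1 + energy k) * moment_bound)"
    using energy_nonneg[of k] moment_bound_nonneg
    by (intro mult_left_mono mult_right_mono) (auto simp: algebra_simps)
  also have "\<dots> = noise_const * (1 + energy k)"
    by (simp add: noise_const_def eval_nat_numeral algebra_simps)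
  finally have "expectation (\<lambda>\<omega>. (\<Sum>a\<in>?P. amp2 k a \<omega> * Z k i a \<omega>)\<^sup>2) \<le> noise_const * (1 + energy k)" .
  then show "expectation (\<lambda>\<omega>. (\<xi> k i \<omega>)\<^sup>2) \<le> noise_const * (1 + energy k)"
    using noise_const_nonneg energy_nonneg[of k]
    by (cases "fail k i") (simp_all add: \<xi>_def[abs_def])
qed

text \<open>Each summand is the past quantity \<open>G * amp2\<close> times an independent centred
  Z. Square integrability of G makes the past factor integrable.\<close>

lemma xi_orthogonal:
  assumes i: "i < N" and sq: "\<And>j. j < N \<Longrightarrow> integrable M (\<lambda>\<omega>. (x k j \<omega>)\<^sup>2)"
    and G: "G \<in> borel_measurable (F k)" and G2: "integrable M (\<lambda>\<omega>. (G \<omega>)\<^sup>2)"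
  shows "expectation (\<lambda>\<omega>. G \<omega> * \<xi> k i \<omega>) = 0"
proof (cases "fail k i")
  case False
  let ?P = "senders k i \<times> senders k i"
  have summand: "integrable M (\<lambda>\<omega>. (G \<omega> * amp2 k a \<omega>) * Z k i a \<omega>) \<and>
      expectation (\<lambda>\<omega>. (G \<omega> * amp2 k a \<omega>) * Z k i a \<omega>) = 0" if a: "a \<in> ?P" for a
  proof -
    have ind: "indep_var borel (\<lambda>\<omega>. G \<omega> * amp2 k a \<omega>) borel (Z k i a)"
      using a by (intro past_now_indep[where k = k] borel_measurable_times G amp2_adapted Z_moments(1)[OF i])
    have int1: "integrable M (\<lambda>\<omega>. G \<omega> * amp2 k a \<omega>)"
      using a by (intro integrable_mult_of_squares G2 amp2_square(1)[OF sq]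
          gen_measurable_M[OF past_used[of k]] G amp2_adapted)
    have int2: "integrable M (Z k i a)"
      by (rule integrable_of_square[OF gen_measurable_M[OF now_used Z_moments(1)[OF i a]] Z_moments(2)[OF i a]])
    show ?thesis
      using indep_var_integrable[OF ind int1 int2] indep_var_lebesgue_integral[OF ind int1 int2]
        Z_moments(4)[OF i a] by simp
  qed
  have "expectation (\<lambda>\<omega>. G \<omega> * \<xi> k i \<omega>) = expectation (\<lambda>\<omega>. \<Sum>a\<in>?P. (G \<omega> * amp2 k a \<omega>) * Z k i a \<omega>)"
    using False by (simp add: \<xi>_def sum_distrib_left mult.assoc)
  also have "\<dots> = (\<Sum>a\<in>?P. expectation (\<lambda>\<omega>. (G \<omega> * amp2 k a \<omega>) * Z k i a \<omega>))"
    using summand by (intro Bochner_Integration.integral_sum) blast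
  also have "\<dots> = 0" using summand by (intro sum.neutral) blast
  finally show ?thesis .
qed (simp add: \<xi>_def)

subsection \<open>Bounded second moments\<close>

definition drifted :: "nat \<Rightarrow> nat \<Rightarrow> 'a \<Rightarrow> real" where
  "drifted k i \<omega> = x k i \<omega> + \<alpha> k * (\<Sum>j<N. A k i j * (\<bar>x k j \<omega>\<bar> - x k i \<omega>))"

lemma x_Suc: "i < N \<Longrightarrow> x (Suc k) i \<omega> = drifted k i \<omega> + \<alpha> k * \<xi> k i \<omega>"
  by (simp add: x_rec drifted_def)

lemma drifted_adapted: "i < N \<Longrightarrow> drifted k i \<in> borel_measurable (F k)"
  unfolding drifted_def[abs_def]
  by (intro borel_measurable_add borel_measurable_times borel_measurable_const
        borel_measurable_sum borel_measurable_diff borel_measurable_abs x_adapted) auto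

text \<open>By the step size condition \<open>drifted k i\<close> is a convex combination of \<open>x k i\<close> and the
  \<open>\<bar>x k j\<bar>\<close>, and the weights are doubly stochastic since \<open>A k\<close> is symmetric.\<close>

lemma sum_drifted_square_le: "(\<Sum>i<N. (drifted k i \<omega>)\<^sup>2) \<le> (\<Sum>i<N. (x k i \<omega>)\<^sup>2)"
proof -
  have a: "0 < \<alpha> k" by (rule alpha_pos)
  have one: "(drifted k i \<omega>)\<^sup>2 \<le>
      (x k i \<omega>)\<^sup>2 + \<alpha> k * (\<Sum>j<N. A k i j * ((x k j \<omega>)\<^sup>2 - (x k i \<omega>)\<^sup>2))" if i: "i < N" for i
  proof -
    let ?s = "\<Sum>j<N. A k i j" and ?y = "x k i \<omega>" and ?z = "\<lambda>j. \<bar>x k j \<omega>\<bar>"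
    let ?d = "\<Sum>j<N. A k i j * (?z j - ?y)"
    have s: "\<alpha> k * ?s \<le> 1" using alpha_abar[OF i, of k] by simp
    have s0: "0 \<le> ?s" using i by (intro sum_nonneg) (auto simp: A_nonneg)
    \<comment> \<open>Splitting each weight into two square roots prepares the weighted
      Cauchy-Schwarz inequality.\<close>
    have "?d\<^sup>2 = (\<Sum>j<N. sqrt (A k i j) * (sqrt (A k i j) * (?z j - ?y)))\<^sup>2"
      using i by (simp add: A_nonneg mult.assoc[symmetric])
    also have "\<dots> \<le> (\<Sum>j<N. (sqrt (A k i j))\<^sup>2) * (\<Sum>j<N. (sqrt (A k i j) * (?z j - ?y))\<^sup>2)"
      by (rule Cauchy_Schwarz_ineq_sum)
    also have "\<dots> = ?s * (\<Sum>j<N. A k i j * (?z j - ?y)\<^sup>2)"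
      using i by (simp add: A_nonneg power_mult_distrib)
    finally have d2: "?d\<^sup>2 \<le> ?s * (\<Sum>j<N. A k i j * (?z j - ?y)\<^sup>2)" .
    have q: "0 \<le> (\<Sum>j<N. A k i j * (?z j - ?y)\<^sup>2)" using i by (intro sum_nonneg) (auto simp: A_nonneg)
    have "(\<alpha> k)\<^sup>2 * ?d\<^sup>2 \<le> (\<alpha> k)\<^sup>2 * (?s * (\<Sum>j<N. A k i j * (?z j - ?y)\<^sup>2))"
      using d2 by (intro mult_left_mono) auto
    also have "\<dots> = \<alpha> k * (\<alpha> k * ?s) * (\<Sum>j<N. A k i j * (?z j - ?y)\<^sup>2)"
      by (simp add: power2_eq_square mult_ac)
    \<comment> \<open>Here \<open>alpha_abar\<close> turns the second-order term in the step size
      into a first-order one.\<close>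
    also have "\<dots> \<le> \<alpha> k * 1 * (\<Sum>j<N. A k i j * (?z j - ?y)\<^sup>2)"
      using s q a by (intro mult_right_mono mult_left_mono) auto
    finally have *: "(\<alpha> k)\<^sup>2 * ?d\<^sup>2 \<le> \<alpha> k * (\<Sum>j<N. A k i j * (?z j - ?y)\<^sup>2)" by simp
    have "(drifted k i \<omega>)\<^sup>2 = ?y\<^sup>2 + \<alpha> k * (2 * ?y * ?d) + (\<alpha> k)\<^sup>2 * ?d\<^sup>2"
      by (simp add: drifted_def power2_sum power_mult_distrib)
    also have "\<dots> \<le> ?y\<^sup>2 + \<alpha> k * (2 * ?y * ?d) + \<alpha> k * (\<Sum>j<N. A k i j * (?z j - ?y)\<^sup>2)"
      using * by simp
    also have "\<dots> = ?y\<^sup>2 + \<alpha> k * (\<Sum>j<N. A k i j * (2 * ?y * (?z j - ?y) + (?z j - ?y)\<^sup>2))"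
      by (simp add: sum_distrib_left distrib_left sum.distrib mult_ac)
    \<comment> \<open>Since
      \<open>2 * y * (z - y) + (z - y)\<^sup>2 = z\<^sup>2 - y\<^sup>2\<close>, only the square of
      \<open>\<bar>x k j\<bar>\<close> remains and the absolute value disappears. Symmetry of the
      weights then cancels these differences in the sum over i.\<close>
    also have "(\<Sum>j<N. A k i j * (2 * ?y * (?z j - ?y) + (?z j - ?y)\<^sup>2)) =
        (\<Sum>j<N. A k i j * ((x k j \<omega>)\<^sup>2 - ?y\<^sup>2))"
      by (intro sum.cong refl) (simp add: power2_diff algebra_simps power2_eq_square)
    finally show ?thesis .
  qed
  have "(\<Sum>i<N. \<Sum>j<N. A k i j * (x k j \<omega>)\<^sup>2) = (\<Sum>i<N. \<Sum>j<N. A k i j * (x k i \<omega>)\<^sup>2)"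
    by (subst sum.swap) (intro sum.cong refl, simp add: A_sym)
  then have zero: "(\<Sum>i<N. \<Sum>j<N. A k i j * ((x k j \<omega>)\<^sup>2 - (x k i \<omega>)\<^sup>2)) = 0"
    by (simp add: right_diff_distrib sum_subtractf)
  have "(\<Sum>i<N. (drifted k i \<omega>)\<^sup>2) \<le>
      (\<Sum>i<N. (x k i \<omega>)\<^sup>2 + \<alpha> k * (\<Sum>j<N. A k i j * ((x k j \<omega>)\<^sup>2 - (x k i \<omega>)\<^sup>2)))"
    using one by (intro sum_mono) auto
  also have "\<dots> = (\<Sum>i<N. (x k i \<omega>)\<^sup>2)"
    by (simp add: sum.distrib sum_distrib_left[symmetric] zero)
  finally show ?thesis .
qed

lemma drifted_square_integrable:
  assumes i: "i < N" and sq: "\<And>j. j < N \<Longrightarrow> integrable M (\<lambda>\<omega>. (x k j \<omega>)\<^sup>2)"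
  shows "integrable M (\<lambda>\<omega>. (drifted k i \<omega>)\<^sup>2)"
proof (rule Bochner_Integration.integrable_bound)
  show "integrable M (\<lambda>\<omega>. \<Sum>i<N. (x k i \<omega>)\<^sup>2)"
    by (intro Bochner_Integration.integrable_sum sq) auto
  have "drifted k i \<in> borel_measurable M"
    by (rule gen_measurable_M[OF past_used drifted_adapted[OF i]])
  then show "(\<lambda>\<omega>. (drifted k i \<omega>)\<^sup>2) \<in> borel_measurable M" by measurable
  have "(drifted k i \<omega>)\<^sup>2 \<le> (\<Sum>i<N. (x k i \<omega>)\<^sup>2)" for \<omega>
    using member_le_sum[of i "{..<N}" "\<lambda>i. (drifted k i \<omega>)\<^sup>2"] i sum_drifted_square_le[of k \<omega>] by auto
  from order_trans[OF this abs_ge_self]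
  show "AE \<omega> in M. norm ((drifted k i \<omega>)\<^sup>2) \<le> norm (\<Sum>i<N. (x k i \<omega>)\<^sup>2)" by simp
qed

lemma x_square_integrable: "i < N \<Longrightarrow> integrable M (\<lambda>\<omega>. (x k i \<omega>)\<^sup>2)"
proof (induction k arbitrary: i)
  case 0
  then show ?case by (simp add: x_def)
next
  case (Suc k)
  note i = Suc.prems
  have "(\<lambda>\<omega>. \<alpha> k * \<xi> k i \<omega>) \<in> borel_measurable M"
    by (intro borel_measurable_times borel_measurable_const xi_measurable[OF i])
  then show ?case
    unfolding x_Suc[OF i]
    by (rule integrable_square_add[OF gen_measurable_M[OF past_used drifted_adapted[OF i]] _
          drifted_square_integrable[OF i Suc.IH] integrable_square_cmult[OF xi_square(1)[OF i Suc.IH]]])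
qed

text \<open>The drifted state is a function of the past, so its cross term with the noise has mean
  zero; the drift does not increase the energy, and the noise adds its variance times
  \<open>(\<alpha> k)\<^sup>2\<close>.\<close>

lemma energy_Suc: "energy (Suc k) \<le> energy k + (\<alpha> k)\<^sup>2 * (real N * noise_const * (1 + energy k))"
proof -
  have "expectation (\<lambda>\<omega>. (x (Suc k) i \<omega>)\<^sup>2) \<le>
      expectation (\<lambda>\<omega>. (drifted k i \<omega>)\<^sup>2) + (\<alpha> k)\<^sup>2 * (noise_const * (1 + energy k))" if i: "i < N" for i
  proof -
    note d2 = drifted_square_integrable[OF i x_square_integrable]
    note xi2 = xi_square[OF i x_square_integrable]
    have dM: "drifted k i \<in> borel_measurable M"
      by (rule gen_measurable_M[OF past_used drifted_adapted[OF i]])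
    have cross: "integrable M (\<lambda>\<omega>. drifted k i \<omega> * \<xi> k i \<omega>)"
      using i by (intro integrable_mult_of_squares dM xi_measurable d2 xi2(1))
    have cross0: "expectation (\<lambda>\<omega>. drifted k i \<omega> * \<xi> k i \<omega>) = 0"
      by (rule xi_orthogonal[OF i x_square_integrable drifted_adapted[OF i] d2])
    have eq: "(x (Suc k) i \<omega>)\<^sup>2 =
        (drifted k i \<omega>)\<^sup>2 + 2 * \<alpha> k * (drifted k i \<omega> * \<xi> k i \<omega>) + (\<alpha> k)\<^sup>2 * (\<xi> k i \<omega>)\<^sup>2" for \<omega>
      unfolding x_Suc[OF i] by (simp add: power2_sum power_mult_distrib algebra_simps)
    have "expectation (\<lambda>\<omega>. (x (Suc k) i \<omega>)\<^sup>2) =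
        expectation (\<lambda>\<omega>. (drifted k i \<omega>)\<^sup>2) + (\<alpha> k)\<^sup>2 * expectation (\<lambda>\<omega>. (\<xi> k i \<omega>)\<^sup>2)"
      unfolding eq using d2 xi2(1) cross cross0 by simp
    also have "\<dots> \<le> expectation (\<lambda>\<omega>. (drifted k i \<omega>)\<^sup>2) + (\<alpha> k)\<^sup>2 * (noise_const * (1 + energy k))"
      using xi2(2) by (intro add_left_mono mult_left_mono) auto
    finally show ?thesis .
  qed
  then have "energy (Suc k) \<le>
      (\<Sum>i<N. expectation (\<lambda>\<omega>. (drifted k i \<omega>)\<^sup>2) + (\<alpha> k)\<^sup>2 * (noise_const * (1 + energy k)))"
    unfolding energy_def[of "Suc k"] by (intro sum_mono) auto
  also have "\<dots> = expectation (\<lambda>\<omega>. \<Sum>i<N. (drifted k i \<omega>)\<^sup>2)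
      + (\<alpha> k)\<^sup>2 * (real N * noise_const * (1 + energy k))"
    using drifted_square_integrable[OF _ x_square_integrable]
    by (subst Bochner_Integration.integral_sum) (auto simp: sum.distrib algebra_simps)
  also have "expectation (\<lambda>\<omega>. \<Sum>i<N. (drifted k i \<omega>)\<^sup>2) \<le> expectation (\<lambda>\<omega>. \<Sum>i<N. (x k i \<omega>)\<^sup>2)"
    using drifted_square_integrable[OF _ x_square_integrable] x_square_integrable
    by (intro integral_mono Bochner_Integration.integrable_sum sum_drifted_square_le) auto
  also have "expectation (\<lambda>\<omega>. \<Sum>i<N. (x k i \<omega>)\<^sup>2) = energy k"
    using x_square_integrable by (simp add: energy_def)
  finally show ?thesis by simp
qed

text \<open>A discrete Gronwall argument: \<open>1 + energy k\<close> grows at most by the factor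
  \<open>1 + ?K * (\<alpha> k)\<^sup>2\<close>, and the product of these factors is bounded because
  the squared step sizes are summable.\<close>

lemma energy_bounded: "\<exists>C. \<forall>k. energy k \<le> C"
proof -
  let ?K = "real N * noise_const"
  have K: "0 \<le> ?K" using noise_const_nonneg by simp
  have step: "1 + energy k \<le> exp (?K * (\<Sum>l<k. (\<alpha> l)\<^sup>2)) * (1 + energy 0)" for k
  proof (induction k)
    case (Suc k)
    have "1 + energy (Suc k) \<le> (1 + ?K * (\<alpha> k)\<^sup>2) * (1 + energy k)"
      using energy_Suc[of k] by (simp add: algebra_simps)
    also have "\<dots> \<le> exp (?K * (\<alpha> k)\<^sup>2) * (1 + energy k)"
      using energy_nonneg[of k] exp_ge_add_one_self[of "?K * (\<alpha> k)\<^sup>2"] by (intro mult_right_mono) auto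
    also have "\<dots> \<le> exp (?K * (\<alpha> k)\<^sup>2) * (exp (?K * (\<Sum>l<k. (\<alpha> l)\<^sup>2)) * (1 + energy 0))"
      by (intro mult_left_mono Suc.IH) auto
    finally show ?case by (simp add: exp_add[symmetric] algebra_simps)
  qed simp
  have "energy k \<le> exp (?K * (\<Sum>l. (\<alpha> l)\<^sup>2)) * (1 + energy 0)" for k
  proof -
    have "exp (?K * (\<Sum>l<k. (\<alpha> l)\<^sup>2)) * (1 + energy 0) \<le> exp (?K * (\<Sum>l. (\<alpha> l)\<^sup>2)) * (1 + energy 0)"
      using K energy_nonneg[of 0] alpha_sq
      by (intro mult_right_mono) (auto intro!: mult_left_mono sum_le_suminf)
    then show ?thesis using step[of k] by linarith
  qed
  then show ?thesis by blast
qed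

text \<open>Bounded energy makes the variance of the k-th increment at most a constant times
  \<open>(\<alpha> k)\<^sup>2\<close>, which brings martingale convergence into play.\<close>

lemma AE_noise_summable:
  assumes i: "i < N"
  shows "AE \<omega> in M. summable (\<lambda>k. \<alpha> k * \<xi> k i \<omega>)"
proof -
  obtain C where C: "\<And>k. energy k \<le> C" using energy_bounded by blast
  note xi2 = xi_square[OF i x_square_integrable]
  interpret square_integrable_martingale_difference M F "\<lambda>k \<omega>. \<alpha> k * \<xi> k i \<omega>"
  proof
    fix n
    show "subalgebra M (F n)" by (rule subalgebra_gen[OF past_used])
    show "sets (F n) \<subseteq> sets (F (Suc n))" by (intro sets_gen_algebra_mono) (auto simp: past_Suc)
    show "(\<lambda>\<omega>. \<alpha> n * \<xi> n i \<omega>) \<in> borel_measurable (F (Suc n))"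
      by (intro borel_measurable_times borel_measurable_const xi_adapted[OF i x_adapted])
    show "integrable M (\<lambda>\<omega>. (\<alpha> n * \<xi> n i \<omega>)\<^sup>2)"
      by (intro integrable_square_cmult xi2(1))
    fix G :: "'a \<Rightarrow> real" assume G: "G \<in> borel_measurable (F n)" "integrable M (\<lambda>\<omega>. (G \<omega>)\<^sup>2)"
    have "expectation (\<lambda>\<omega>. \<alpha> n * (G \<omega> * \<xi> n i \<omega>)) = 0"
      using xi_orthogonal[OF i x_square_integrable G] by simp
    then show "expectation (\<lambda>\<omega>. G \<omega> * (\<alpha> n * \<xi> n i \<omega>)) = 0" by (simp add: mult_ac)
  next
    have "norm (expectation (\<lambda>\<omega>. (\<alpha> n * \<xi> n i \<omega>)\<^sup>2)) \<le> noise_const * (1 + C) * (\<alpha> n)\<^sup>2" for n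
    proof -
      have "expectation (\<lambda>\<omega>. (\<alpha> n * \<xi> n i \<omega>)\<^sup>2) = (\<alpha> n)\<^sup>2 * expectation (\<lambda>\<omega>. (\<xi> n i \<omega>)\<^sup>2)"
        by (simp add: power_mult_distrib)
      also have "\<dots> \<le> (\<alpha> n)\<^sup>2 * (noise_const * (1 + energy n))"
        by (intro mult_left_mono xi2(2)) auto
      also have "\<dots> \<le> (\<alpha> n)\<^sup>2 * (noise_const * (1 + C))"
        using C[of n] noise_const_nonneg by (intro mult_left_mono) auto
      finally show ?thesis by (simp add: mult_ac)
    qed
    then show "summable (\<lambda>n. expectation (\<lambda>\<omega>. (\<alpha> n * \<xi> n i \<omega>)\<^sup>2))"
      by (intro summable_comparison_test'[OF summable_mult[OF alpha_sq], of 0 _ "noise_const * (1 + C)"])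
  qed
  show ?thesis by (rule AE_summable)
qed

section \<open>Summability of the excess caused by negative states\<close>

text \<open>The drift of the mean is nonnegative and sums to a bounded expectation. Hence the effect of
  negative states, at which the amplitude carries \<open>\<bar>x\<bar>\<close> instead of \<open>x\<close>, is almost surely summable.\<close>

definition excess :: "nat \<Rightarrow> nat \<Rightarrow> 'a \<Rightarrow> real" where
  "excess k i \<omega> = (\<Sum>j<N. A k i j * (\<bar>x k j \<omega>\<bar> - x k j \<omega>))"

lemma x_integrable: "i < N \<Longrightarrow> integrable M (x k i)"
  by (rule integrable_of_square[OF x_measurable x_square_integrable])

lemma excess_nonneg: "i < N \<Longrightarrow> 0 \<le> excess k i \<omega>"
  unfolding excess_def by (intro sum_nonneg mult_nonneg_nonneg) (auto simp: A_nonneg)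

lemma excess_integrable: "i < N \<Longrightarrow> integrable M (excess k i)"
  unfolding excess_def[abs_def]
  by (intro Bochner_Integration.integrable_sum integrable_mult_right
      Bochner_Integration.integrable_diff integrable_abs x_integrable) auto

lemma x_laplacian_rec:
  assumes "i < N"
  shows "x (Suc k) i \<omega> = x k i \<omega> - \<alpha> k * laplacian N (A k) (\<lambda>j. x k j \<omega>) i
    + (\<alpha> k * excess k i \<omega> + \<alpha> k * \<xi> k i \<omega>)"
proof -
  have eq: "(\<Sum>j<N. A k i j * (\<bar>x k j \<omega>\<bar> - x k i \<omega>)) = excess k i \<omega> - laplacian N (A k) (\<lambda>j. x k j \<omega>) i"
    unfolding excess_def laplacian_def sum_subtractf[symmetric]
    by (intro sum.cong refl) (simp add: algebra_simps)
  show ?thesis unfolding x_rec[OF assms] eq by (simp add: algebra_simps)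
qed

lemma expectation_xi: "i < N \<Longrightarrow> expectation (\<xi> k i) = 0"
  using xi_orthogonal[OF _ x_square_integrable, of i "\<lambda>_. 1" k] by simp

lemma xi_integrable: "i < N \<Longrightarrow> integrable M (\<xi> k i)"
  by (rule integrable_of_square[OF xi_measurable xi_square(1)[OF _ x_square_integrable]])

lemma sum_x_Suc:
  "(\<Sum>i<N. x (Suc k) i \<omega>) = (\<Sum>i<N. x k i \<omega>) + \<alpha> k * (\<Sum>i<N. excess k i \<omega>) + \<alpha> k * (\<Sum>i<N. \<xi> k i \<omega>)"
proof -
  have "(\<Sum>i<N. x (Suc k) i \<omega>) = (\<Sum>i<N. x k i \<omega>) - \<alpha> k * (\<Sum>i<N. laplacian N (A k) (\<lambda>j. x k j \<omega>) i)
      + (\<alpha> k * (\<Sum>i<N. excess k i \<omega>) + \<alpha> k * (\<Sum>i<N. \<xi> k i \<omega>))"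
    by (simp add: x_laplacian_rec sum.distrib sum_subtractf sum_distrib_left)
  moreover have "(\<Sum>i<N. laplacian N (A k) (\<lambda>j. x k j \<omega>) i) = 0"
    by (intro sum_laplacian A_sym)
  ultimately show ?thesis by simp
qed

lemma AE_excess_summable: "AE \<omega> in M. \<forall>i<N. summable (\<lambda>k. \<alpha> k * excess k i \<omega>)"
proof -
  obtain C where C: "\<And>k. energy k \<le> C" using energy_bounded by blast
  define f where "f k \<omega> = \<alpha> k * (\<Sum>i<N. excess k i \<omega>)" for k \<omega>
  define m where "m k = expectation (\<lambda>\<omega>. \<Sum>i<N. x k i \<omega>)" for k
  have f_int: "integrable M (f k)" for k
    unfolding f_def[abs_def] using excess_integrable by auto
  have f_nonneg: "0 \<le> f k \<omega>" for k \<omega>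
    unfolding f_def using alpha_pos[of k] by (intro mult_nonneg_nonneg sum_nonneg) (auto simp: excess_nonneg)
  have m_Suc: "m (Suc k) = m k + expectation (f k)" for k
  proof -
    have "m (Suc k) = expectation (\<lambda>\<omega>. (\<Sum>i<N. x k i \<omega>) + f k \<omega> + \<alpha> k * (\<Sum>i<N. \<xi> k i \<omega>))"
      unfolding m_def f_def by (simp only: sum_x_Suc)
    also have "\<dots> = m k + expectation (f k) + \<alpha> k * (\<Sum>i<N. expectation (\<xi> k i))"
    proof -
      have "integrable M (\<lambda>\<omega>. \<Sum>i<N. x k i \<omega>)" "integrable M (\<lambda>\<omega>. \<Sum>i<N. \<xi> k i \<omega>)"
        using x_integrable xi_integrable by auto
      moreover from this(1) have "integrable M (\<lambda>\<omega>. (\<Sum>i<N. x k i \<omega>) + f k \<omega>)"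
        using f_int by (intro Bochner_Integration.integrable_add)
      moreover have "expectation (\<lambda>\<omega>. \<Sum>i<N. \<xi> k i \<omega>) = (\<Sum>i<N. expectation (\<xi> k i))"
        using xi_integrable by (intro Bochner_Integration.integral_sum) auto
      ultimately show ?thesis
        unfolding m_def using f_int[of k]
        by (simp only: Bochner_Integration.integral_add integrable_mult_right integral_mult_right_zero)
    qed
    finally show ?thesis by (simp add: expectation_xi)
  qed
  have m_le: "\<bar>m k\<bar> \<le> real N + C" for k
  proof -
    have "\<bar>m k\<bar> \<le> expectation (\<lambda>\<omega>. \<bar>\<Sum>i<N. x k i \<omega>\<bar>)"
      unfolding m_def by (rule integral_abs_bound)
    also have "\<dots> \<le> expectation (\<lambda>\<omega>. \<Sum>i<N. 1 + (x k i \<omega>)\<^sup>2)"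
    proof (rule integral_mono)
      show "integrable M (\<lambda>\<omega>. \<bar>\<Sum>i<N. x k i \<omega>\<bar>)"
        by (intro integrable_abs Bochner_Integration.integrable_sum x_integrable) auto
      show "integrable M (\<lambda>\<omega>. \<Sum>i<N. 1 + (x k i \<omega>)\<^sup>2)"
        by (intro Bochner_Integration.integrable_sum Bochner_Integration.integrable_add
            integrable_const x_square_integrable) auto
      fix \<omega>
      have "\<bar>t\<bar> \<le> 1 + t\<^sup>2" for t :: real
        using sum_squares_bound[of 1 "\<bar>t\<bar>"] by simp
      then show "\<bar>\<Sum>i<N. x k i \<omega>\<bar> \<le> (\<Sum>i<N. 1 + (x k i \<omega>)\<^sup>2)"
        by (intro order_trans[OF sum_abs sum_mono])
    qed
    also have "\<dots> = real N + energy k"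
      using energy_sum[OF x_square_integrable, of k] by (simp add: sum.distrib prob_space)
    finally show ?thesis using C[of k] by linarith
  qed
  \<comment> \<open>The noise is centred, so the expected drifts telescope to a difference of two
    means, each bounded through the energy by \<open>m_le\<close>.\<close>
  have "(\<Sum>k<n. expectation (f k)) = m n - m 0" for n
    by (induction n) (simp_all add: m_Suc)
  then have "(\<Sum>k<n. expectation (f k)) \<le> 2 * (real N + C)" for n
    using m_le[of n] m_le[of 0] by (simp add: abs_le_iff)
  from AE_summable_of_integrals[OF f_int f_nonneg this]
  show ?thesis
  proof (rule AE_mp, intro AE_I2 impI allI)
    fix \<omega> i assume f: "summable (\<lambda>n. f n \<omega>)" and i: "i < N"
    show "summable (\<lambda>k. \<alpha> k * excess k i \<omega>)"
    proof (rule summable_comparison_test'[OF f])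
      fix k
      have "excess k i \<omega> \<le> (\<Sum>i<N. excess k i \<omega>)"
        using i by (intro member_le_sum[where f = "\<lambda>i. excess k i \<omega>"]) (auto simp: excess_nonneg)
      then show "norm (\<alpha> k * excess k i \<omega>) \<le> f k \<omega>"
        using alpha_pos[of k] excess_nonneg[OF i, of k \<omega>] by (simp add: f_def abs_mult)
    qed
  qed
qed

lemma AE_perturbation_summable:
  "AE \<omega> in M. \<forall>i<N. summable (\<lambda>k. \<alpha> k * excess k i \<omega> + \<alpha> k * \<xi> k i \<omega>)"
proof -
  have "AE \<omega> in M. \<forall>i\<in>{..<N}. summable (\<lambda>k. \<alpha> k * \<xi> k i \<omega>)"
    by (rule AE_finite_allI) (auto simp: AE_noise_summable)
  with AE_excess_summable show ?thesis
    by eventually_elim (auto intro: summable_add)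
qed

section \<open>Passage from the probabilistic estimates to consensus\<close>

definition weight :: "nat \<Rightarrow> nat \<Rightarrow> real" where
  "weight i j = \<rho> * (p i * (1 - p j) + p j * (1 - p i)) * \<Lambda> i j"

lemma weight_pos: "i < N \<Longrightarrow> j < N \<Longrightarrow> 0 < weight i j"
  using p[of i] p[of j] Lam[of i j] rho
  by (auto simp: weight_def intro!: mult_pos_pos add_pos_pos)

lemma A_eq: "A k i j = (if E k i j then weight i j else 0)"
  by (simp add: abar_def weight_def)

theorem almost_sure_consensus:
  assumes alpha_sum: "filterlim (\<lambda>n. \<Sum>k<n. \<alpha> k) at_top sequentially"
    and L: "L > 0"
    and Lconn: "\<And>k. graph_connected N (\<lambda>i j. \<exists>l\<in>{k..<k + L}. E l i j)"
    and alpha_mono: "\<And>k. \<alpha> (Suc k) \<le> \<alpha> k"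
    and alpha_ratio: "limsup (\<lambda>k. ereal (\<alpha> k / \<alpha> (Suc k))) < \<infinity>"
  shows "\<exists>xstar. xstar \<in> borel_measurable M \<and> (AE \<omega> in M. \<forall>i<N. (\<lambda>k. x k i \<omega>) \<longlonglongrightarrow> xstar \<omega>)"
proof -
  \<comment> \<open>On an edge the weight does not depend on time. The finitely many positive values
    \<open>weight i j\<close> therefore have a positive minimum and a maximum, which serve as b and
    K for all times.\<close>
  let ?W = "(\<lambda>(i, j). weight i j) ` ({..<N} \<times> {..<N})"
  have W: "finite ?W" "?W \<noteq> {}" using N by (auto simp: lessThan_empty_iff)
  obtain B where B: "limsup (\<lambda>k. ereal (\<alpha> k / \<alpha> (Suc k))) < ereal B"
    using alpha_ratio less_PInf_Ex_of_nat by (metis ereal_dense2)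
  interpret averaging_recursion N L A \<alpha> "Max ?W" "Min ?W" B
  proof
    show "N \<ge> 1" by (rule N)
    show "L > 0" by (rule L)
    show "A k i j = A k j i" if "i < N" "j < N" for k i j using that by (rule A_sym)
    have weight_le: "weight i j \<le> Max ?W" "Min ?W \<le> weight i j" if "i < N" "j < N" for i j
      using that W by (auto intro!: Max_ge Min_le image_eqI[of _ _ "(i, j)"])
    show "0 \<le> A k i j \<and> A k i j \<le> Max ?W" if "i < N" "j < N" for k i j
      using weight_le[OF that] weight_pos[OF that] by (auto simp: A_eq)
    show "0 < Min ?W" using W by (auto simp: weight_pos)
    show "graph_connected N (\<lambda>i j. \<exists>l\<in>{k..<k + L}. Min ?W \<le> A l i j)" for k
    proof -
      have "{(a, b). a < N \<and> b < N \<and> (\<exists>l\<in>{k..<k + L}. E l a b)}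
          \<subseteq> {(a, b). a < N \<and> b < N \<and> (\<exists>l\<in>{k..<k + L}. Min ?W \<le> A l a b)}"
        using weight_le(2) by (fastforce simp: A_eq)
      from rtrancl_mono[OF this] show ?thesis
        using Lconn[of k] unfolding graph_connected_def by blast
    qed
    show "0 < \<alpha> k" for k by (rule alpha_pos)
    show "\<alpha> (Suc k) \<le> \<alpha> k" for k by (rule alpha_mono)
    show "filterlim (\<lambda>n. \<Sum>k<n. \<alpha> k) at_top sequentially" by (rule alpha_sum)
    have "(\<lambda>k. sqrt ((\<alpha> k)\<^sup>2)) \<longlonglongrightarrow> sqrt 0"
      by (intro tendsto_real_sqrt summable_LIMSEQ_zero alpha_sq)
    then show "\<alpha> \<longlonglongrightarrow> 0" using alpha_pos by (simp add: less_imp_le)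
    have "\<forall>\<^sub>F k in sequentially. ereal (\<alpha> k / \<alpha> (Suc k)) < ereal B"
      by (rule Limsup_lessD[OF B])
    then show "\<forall>\<^sub>F k in sequentially. \<alpha> k \<le> B * \<alpha> (Suc k)"
    proof eventually_elim
      case (elim k)
      then show ?case using alpha_pos[of "Suc k"] by (simp add: field_simps)
    qed
  qed
  have conv: "AE \<omega> in M. \<exists>c. \<forall>i<N. (\<lambda>k. x k i \<omega>) \<longlonglongrightarrow> c"
    using AE_perturbation_summable
  proof eventually_elim
    case (elim \<omega>)
    show ?case
      by (rule perturbed_consensus[where x = "\<lambda>k i. x k i \<omega>"
            and w = "\<lambda>k i. \<alpha> k * excess k i \<omega> + \<alpha> k * \<xi> k i \<omega>"])
        (use elim in \<open>auto simp: x_laplacian_rec\<close>)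
  qed
  show ?thesis
  proof (intro exI conjI)
    \<comment> \<open>Agent 0 exists since \<open>N \<ge> 1\<close>. Its limit is a measurable
      function on the whole space and agrees with the common limit wherever the states converge to
      one.\<close>
    show "(\<lambda>\<omega>. lim (\<lambda>k. x k 0 \<omega>)) \<in> borel_measurable M"
      using N by (intro borel_measurable_lim_metric x_measurable) auto
    show "AE \<omega> in M. \<forall>i<N. (\<lambda>k. x k i \<omega>) \<longlonglongrightarrow> lim (\<lambda>k. x k 0 \<omega>)"
      using conv
    proof eventually_elim
      case (elim \<omega>)
      then obtain c where c: "\<forall>i<N. (\<lambda>k. x k i \<omega>) \<longlonglongrightarrow> c" by blast
      then have "lim (\<lambda>k. x k 0 \<omega>) = c" using N by (intro limI) auto
      with c show ?case by simp
    qed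
  qed
qed

end

theorem theorem6:
  fixes M :: "'a measure"
    and N :: nat
    and E :: "nat \<Rightarrow> nat \<Rightarrow> nat \<Rightarrow> bool"
    and fail :: "nat \<Rightarrow> nat \<Rightarrow> bool"
    and \<rho> :: real and u :: complex and xmax :: real
    and p :: "nat \<Rightarrow> real" and \<Lambda> :: "nat \<Rightarrow> nat \<Rightarrow> real" and \<sigma> :: "nat \<Rightarrow> real"
    and \<alpha> :: "nat \<Rightarrow> real" and x0 :: "nat \<Rightarrow> real"
    and X :: "rv_idx \<Rightarrow> 'a \<Rightarrow> complex"
    and L :: nat
  assumes M: "prob_space M"
    and N: "N \<ge> 1"
    and E_sym: "\<And>k i j. E k i j \<longleftrightarrow> E k j i"
    and E_irrefl: "\<And>k i. \<not> E k i i"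
    and E_V: "\<And>k i j. E k i j \<Longrightarrow> i < N \<and> j < N"
    and fail_noedge: "\<And>k i j. fail k i \<Longrightarrow> \<not> E k i j"
    and x0: "\<And>i. i < N \<Longrightarrow> 0 \<le> x0 i \<and> x0 i \<le> xmax"
    and rho: "\<rho> > 0"
    and u: "cmod u = 1"
    and p: "\<And>i. i < N \<Longrightarrow> 0 < p i \<and> p i < 1"
    and Lam: "\<And>i j. i < N \<Longrightarrow> j < N \<Longrightarrow> \<Lambda> i j = \<Lambda> j i \<and> \<Lambda> i j > 0"
    and sigma: "\<And>i. i < N \<Longrightarrow> \<sigma> i > 0"
    and indep: "prob_space.indep_vars M (\<lambda>_. borel) X (used_idx N)"
    and gam01: "\<And>i k \<omega>. i < N \<Longrightarrow> \<omega> \<in> space M \<Longrightarrow> X (Gam i k) \<omega> \<in> {0, 1}"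
    and gam_p: "\<And>i k. i < N \<Longrightarrow> measure M {\<omega> \<in> space M. X (Gam i k) \<omega> = 1} = p i"
    and chan: "\<And>i j k. i < N \<Longrightarrow> j < N \<Longrightarrow> i \<noteq> j \<Longrightarrow>
                 distributed M lborel (X (Chan i j k)) (cn_density (\<Lambda> i j))"
    and noise: "\<And>i k. i < N \<Longrightarrow>
                 distributed M lborel (X (Noise i k)) (cn_density ((\<sigma> i)\<^sup>2))"
    and alpha_pos: "\<And>k. \<alpha> k > 0"
    and alpha_sum: "filterlim (\<lambda>n. \<Sum>k<n. \<alpha> k) at_top sequentially"
    and alpha_sq: "summable (\<lambda>k. (\<alpha> k)\<^sup>2)"
    and alpha_abar: "\<And>i k. i < N \<Longrightarrow> 1 - \<alpha> k * (\<Sum>j<N. abar E \<rho> p \<Lambda> k i j) > 0"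
    and L: "L > 0"
    and Lconn: "\<And>k. graph_connected N (\<lambda>i j. \<exists>l\<in>{k..<k + L}. E l i j)"
    and alpha_mono: "\<And>k. \<alpha> (Suc k) \<le> \<alpha> k"
    and alpha_ratio: "limsup (\<lambda>k. ereal (\<alpha> k / \<alpha> (Suc k))) < \<infinity>"
  shows "\<exists>xstar. xstar \<in> borel_measurable M \<and>
           (AE \<omega> in M. \<forall>i<N.
              (\<lambda>k. state N E fail \<rho> u p \<Lambda> \<sigma> \<alpha> x0 X k i \<omega>) \<longlonglongrightarrow> xstar \<omega>)"
proof -
  interpret prob_space M by (rule M)
  interpret ota_consensus M N E fail \<rho> u p \<Lambda> \<sigma> \<alpha> x0 X
    by unfold_locales fact+
  show ?thesis
    using almost_sure_consensus[OF alpha_sum L Lconn alpha_mono alpha_ratio] unfolding x_def .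
qed

end
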